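(* Let $d\geq 2$ be an integer. For each $1\leq i\leq d$, let $\beta_i>1$ be a real number and let $\psi_i:\mathbb{R}_{>0}\to\mathbb{R}_{>0}$ be a non-increasing function with $\psi_i(n)\to 0$ as $n\to\infty$. Then \[ \dim_{\mathcal H}\big(E_{\beta_1}(\psi_1)\times\cdots\times E_{\beta_d}(\psi_d)\big) =\min_{1\leq i\leq d}\Big\{d-1+\dim_{\mathcal H}E_{\beta_i}(\psi_i)\Big\} =\min_{1\leq i\leq d}\Big\{d-1+\frac{1}{1+\alpha_i}\Big\}, \] where \[ \alpha_i=\liminf_{n\to\infty}\frac{-\log_{\beta_i}\psi_i(n)}{n}. \]
   Context: $\dim_{\mathcal H}$ denotes Hausdorff dimension. For a real number $\beta>1$, the $\beta$-transformation is $T_\beta:[0,1]\to[0,1]$, $T_\beta(x)=\beta x-\lfloor \beta x\rfloor$. Every $x\in[0,1]$ has the $\beta$-expansion $x=\sum_{n\geq1}\varepsilon_n(x)\beta^{-n}$ with digits $\varepsilon_1(x)=\lfloor \beta x\rfloor$ and $\varepsilon_{n+1}(x)=\varepsilon_1(T_\beta^n(x))$. The $n$-th convergent of $x$ is $\omega_n(x)=\sum_{k=1}^n \varepsilon_k(x)\beta^{-k}$; one always has $|x-\omega_n(x)|<\beta^{-n}$. For a positive function $\psi$ on $\mathbb{N}$, define \[ W_\beta(\psi)=\Big\{x\in[0,1]: |x-\omega_n(x)|<\frac{\psi(n)}{\beta^n}\text{ for infinitely many } n\in\mathbb{N}\Big\}, \] and the exact approximation set \[ E_\beta(\psi)=W_\beta(\psi)\setminus\bigcup_{0<c<1}W_\beta(c\psi),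 \] i.e. the points approximable by their $\beta$-convergents to order $\psi$ but not to order $c\psi$ for any $0<c<1$. (Convention: if $\alpha_i=\infty$, then $\frac{1}{1+\alpha_i}=0$.) *)

theory Defs
  imports "HOL-Analysis.Analysis"
begin

text \<open>
  The contribution \<open>(diam U)\<^sup>s\<close> of a covering set. In HOL \<open>0 powr 0 = 0\<close>, so the exponent \<open>0\<close>
  is treated separately: \<open>\<H>\<^sup>0\<close> has to be the counting measure, with the empty set
  contributing nothing.
\<close>

definition diam_gauge :: "real \<Rightarrow> 'a::metric_space set \<Rightarrow> ennreal" where
  "diam_gauge s U =
     (if U = {} then 0 else if s = 0 then 1 else ennreal (diameter U powr s))"

text \<open>
  \<^const>\<open>diameter\<close> carries no information on unbounded sets, hence the explicit boundedness
  requirement on the members of a cover.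
\<close>

definition delta_covers :: "real \<Rightarrow> 'a::metric_space set \<Rightarrow> (nat \<Rightarrow> 'a set) set" where
  "delta_covers \<delta> A =
     {U. A \<subseteq> (\<Union>i. U i) \<and> (\<forall>i. bounded (U i) \<and> diameter (U i) \<le> \<delta>)}"

definition hausdorff_content :: "real \<Rightarrow> real \<Rightarrow> 'a::metric_space set \<Rightarrow> ennreal" where
  "hausdorff_content s \<delta> A = (INF U \<in> delta_covers \<delta> A. \<Sum>i. diam_gauge s (U i))"

definition hausdorff_measure :: "real \<Rightarrow> 'a::metric_space set \<Rightarrow> ennreal" where
  "hausdorff_measure s A = (SUP \<delta> \<in> {0<..}. hausdorff_content s \<delta> A)"

definition hausdorff_dim :: "'a::metric_space set \<Rightarrow> ereal" where
  "hausdorff_dim A = Inf (ereal ` {s. 0 \<le> s \<and> hausdorff_measure s A = 0})"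

definition beta_map :: "real \<Rightarrow> real \<Rightarrow> real" where
  "beta_map \<beta> x = \<beta> * x - of_int \<lfloor>\<beta> * x\<rfloor>"

text \<open>Digits are indexed from \<open>1\<close>; the value at index \<open>0\<close> is never used.\<close>

definition beta_digit :: "real \<Rightarrow> nat \<Rightarrow> real \<Rightarrow> int" where
  "beta_digit \<beta> n x = \<lfloor>\<beta> * (beta_map \<beta> ^^ (n - 1)) x\<rfloor>"

definition beta_convergent :: "real \<Rightarrow> nat \<Rightarrow> real \<Rightarrow> real" where
  "beta_convergent \<beta> n x = (\<Sum>k=1..n. of_int (beta_digit \<beta> k x) / \<beta> ^ k)"

definition W_set :: "real \<Rightarrow> (nat \<Rightarrow> real) \<Rightarrow> real set" where
  "W_set \<beta> \<psi> =
     {x \<in> {0..1}. \<exists>\<^sub>\<infinity>n. \<bar>x - beta_convergent \<beta> n x\<bar> < \<psi> n / \<beta> ^ n}"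

definition E_set :: "real \<Rightarrow> (nat \<Rightarrow> real) \<Rightarrow> real set" where
  "E_set \<beta> \<psi> = W_set \<beta> \<psi> - (\<Union>c \<in> {0<..<1}. W_set \<beta> (\<lambda>n. c * \<psi> n))"

text \<open>
  The lower order at infinity of \<open>\<psi>\<close> in base \<open>\<beta>\<close>, possibly \<open>\<infinity>\<close>. The arithmetic of \<^typ>\<open>ereal\<close>
  gives \<open>1 / (1 + \<infinity>) = 0\<close>.
\<close>

definition lower_order :: "real \<Rightarrow> (nat \<Rightarrow> real) \<Rightarrow> ereal" where
  "lower_order \<beta> \<psi> = liminf (\<lambda>n. ereal (- log \<beta> (\<psi> n) / real n))"

end

theory Submission
  imports Defs "HOL-Probability.Probability"
begin

text \<open>
  Since \<open>x - \<omega>\<^sub>n(x) = T\<^sup>n x / \<beta>\<^sup>n\<close>, everything is a statement about returns of the orbit to \<open>0\<close>.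
  Counting convergents gives \<open>dim E \<le> 1 / (1 + \<alpha>)\<close>, and a product is contained in a cylinder over
  each factor, so its dimension is at most \<open>d - 1 + dim E\<^sub>i\<close>.

  For the lower bound, points of each factor are coded by free blocks of a fixed length \<open>m\<close> (full
  words that keep the orbit away from \<open>0\<close>), interrupted by sparse deterministic blocks that force
  \<open>T\<^sup>n x\<close> into \<open>{(1 - \<eta>) \<psi>(n)..<\<psi>(n)}\<close> with \<open>\<eta> \<rightarrow> 0\<close>. The deterministic blocks of different
  factors are separated on the logarithmic scale, each one beginning much later than the previous one
  ended. Hence at every scale only one factor loses mass, namely at most the fraction
  \<open>\<alpha>\<^sub>i / (1 + \<alpha>\<^sub>i)\<close> of the exponent, and the uniform measure on codes has the required local dimension.
  Applied to \<open>d\<close> copies of one factor, the two bounds for products also give \<open>dim E\<^sub>i \<ge> 1 / (1 + \<alpha>\<^sub>i)\<close>.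
\<close>

subsection \<open>Hausdorff measure and dimension\<close>

text \<open>Digit words in base \<beta> cannot be concatenated freely, but full words can. There are
  at least \<open>\<beta> ^ n / (real n + 3) - 1\<close> of them of length \<open>n\<close>, so
  blocks of one long fixed length cost an arbitrarily small part of the exponent. The general
  inequality for products bounds the dimension below only by the sum of the numbers
  \<open>1 / (1 + \<alpha>)\<close>, which is in general too small; the gain comes from timing.
  Since \<alpha> is a liminf, the returns may be taken from arbitrarily sparse times, and a factor
  recovers its whole exponent between two of them. The clock \<open>t = n * ln \<beta>\<close> makes
  different bases comparable: a full cylinder of order \<open>n\<close> has length
  \<open>exp (- t)\<close>. Exactness in \<open>E_set\<close> requires a lower bound for the orbit
  at all large times, not only at the forced returns; for this reason every block, free or special,
  starts at height at least \<open>1 / \<beta> ^ m\<close>. Block starts can be steered only up to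
  \<open>m\<close> positions, and monotonicity of \<psi> lets one good time serve a whole window of
  starts.\<close>

lemma hausdorff_dim_le: "0 \<le> s \<Longrightarrow> hausdorff_measure s A = 0 \<Longrightarrow> hausdorff_dim A \<le> ereal s"
  unfolding hausdorff_dim_def by (intro Inf_lower) auto

lemma hausdorff_dim_geI:
  "(\<And>s. 0 \<le> s \<Longrightarrow> hausdorff_measure s A = 0 \<Longrightarrow> c \<le> ereal s) \<Longrightarrow> c \<le> hausdorff_dim A"
  unfolding hausdorff_dim_def by (intro Inf_greatest) auto

lemma hausdorff_measure_zeroI:
  assumes "\<And>\<delta> \<epsilon>. 0 < \<delta> \<Longrightarrow> 0 < \<epsilon> \<Longrightarrow> hausdorff_content s \<delta> A \<le> ennreal \<epsilon>"
  shows "hausdorff_measure s A = 0"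
proof -
  have "hausdorff_content s \<delta> A \<le> 0" if "0 < \<delta>" for \<delta>
    by (rule ennreal_le_epsilon) (use assms[OF that] in auto)
  then have "hausdorff_measure s A \<le> 0" unfolding hausdorff_measure_def by (auto intro!: SUP_least)
  then show ?thesis by simp
qed

lemma hausdorff_measure_zeroD:
  assumes "hausdorff_measure s A = 0" "0 < \<delta>" "0 < \<epsilon>"
  obtains U where "A \<subseteq> (\<Union>i. U i)" "\<And>i. bounded (U i)" "\<And>i. diameter (U i) \<le> \<delta>"
    "(\<Sum>i. diam_gauge s (U i)) < ennreal \<epsilon>"
proof -
  have "hausdorff_content s \<delta> A \<le> hausdorff_measure s A"
    unfolding hausdorff_measure_def using assms(2) by (intro SUP_upper) auto
  then have "hausdorff_content s \<delta> A < ennreal \<epsilon>" using assms by simp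
  then show thesis unfolding hausdorff_content_def INF_less_iff using that by (auto simp: delta_covers_def)
qed

text \<open>The upper bounds produce finitely many sets per level, whereas
  \<open>delta_covers\<close> wants one sequence. \<open>prod_decode\<close> interleaves the levels,
  and the surplus indices of a level receive the empty set, which \<open>diam_gauge\<close> counts
  as 0.\<close>

lemma hausdorff_content_le_levels:
  fixes G :: "nat \<Rightarrow> 'a::metric_space set set"
  assumes "0 < s" "A \<subseteq> (\<Union>n. \<Union>(G n))" "\<And>n. finite (G n)"
    and "\<And>n U. U \<in> G n \<Longrightarrow> bounded U \<and> diameter U \<le> \<rho> n"
    and "\<And>n. 0 \<le> \<rho> n" "\<And>n. \<rho> n \<le> \<delta>"
    and "(\<Sum>n. ennreal (real (card (G n)) * \<rho> n powr s)) \<le> \<epsilon>"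
  shows "hausdorff_content s \<delta> A \<le> \<epsilon>"
proof -
  have "\<exists>h. bij_betw h {..<card (G n)} (G n)" for n
    using ex_bij_betw_nat_finite[OF assms(3)] by (auto simp: lessThan_atLeast0)
  then obtain h where h: "\<And>n. bij_betw (h n) {..<card (G n)} (G n)" by metis
  define V where "V p = (if snd p < card (G (fst p)) then h (fst p) (snd p) else {})" for p
  define U where "U k = V (prod_decode k)" for k
  have hG: "h n i \<in> G n" if "i < card (G n)" for n i using bij_betwE[OF h] that by auto
  have "A \<subseteq> (\<Union>k. U k)"
  proof
    fix x assume "x \<in> A"
    then obtain n X where "X \<in> G n" "x \<in> X" using assms(2) by auto
    moreover from this obtain i where "i < card (G n)" "h n i = X"
      using bij_betw_imp_surj_on[OF h] by (metis imageE lessThan_iff)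
    ultimately have "x \<in> U (prod_encode (n, i))" by (simp add: U_def V_def)
    then show "x \<in> (\<Union>k. U k)" by blast
  qed
  moreover have "bounded (U k) \<and> diameter (U k) \<le> \<delta>" for k
  proof -
    obtain n i where k: "prod_decode k = (n, i)" by fastforce
    have "0 \<le> \<delta>" using assms(5,6) order_trans by blast
    moreover have "bounded (h n i) \<and> diameter (h n i) \<le> \<delta>" if "i < card (G n)"
      using assms(4)[OF hG[OF that]] assms(6)[of n] by linarith
    ultimately show ?thesis by (simp add: U_def V_def k)
  qed
  ultimately have "U \<in> delta_covers \<delta> A" by (auto simp: delta_covers_def)
  then have "hausdorff_content s \<delta> A \<le> (\<Sum>k. diam_gauge s (U k))"
    unfolding hausdorff_content_def by (intro INF_lower)
  also have "\<dots> = (\<Sum>n. \<Sum>i. diam_gauge s (V (n, i)))"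
    unfolding U_def by (rule suminf_ennreal_2dimen) simp
  also have "\<dots> \<le> (\<Sum>n. ennreal (real (card (G n)) * \<rho> n powr s))"
  proof (intro suminf_le allI summableI)
    fix n
    have "(\<Sum>i. diam_gauge s (V (n, i))) = (\<Sum>i<card (G n). diam_gauge s (V (n, i)))"
      by (intro suminf_finite) (auto simp: V_def diam_gauge_def)
    also have "\<dots> \<le> (\<Sum>i<card (G n). ennreal (\<rho> n powr s))"
    proof (intro sum_mono)
      fix i assume "i \<in> {..<card (G n)}"
      then have X: "V (n, i) = h n i" "bounded (h n i)" "diameter (h n i) \<le> \<rho> n"
        using assms(4)[OF hG] by (auto simp: V_def)
      have "diameter (h n i) powr s \<le> \<rho> n powr s"
        using X assms(1) by (intro powr_mono2 diameter_ge_0) auto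
      then show "diam_gauge s (V (n, i)) \<le> ennreal (\<rho> n powr s)"
        using assms(1) X by (auto simp: diam_gauge_def)
    qed
    also have "\<dots> = ennreal (real (card (G n)) * \<rho> n powr s)"
      by (simp add: ennreal_mult ennreal_of_nat_eq_real_of_nat)
    finally show "(\<Sum>i. diam_gauge s (V (n, i))) \<le> ennreal (real (card (G n)) * \<rho> n powr s)" .
  qed
  finally show ?thesis using assms(7) by (rule order_trans)
qed

text \<open>At exponent 0 a single non-empty covering set already costs 1. This settles the boundary
  case of arguments that need a positive exponent.\<close>

lemma hausdorff_measure_0_empty:
  assumes "hausdorff_measure 0 A = 0" shows "A = {}"
proof (rule ccontr)
  assume ne: "A \<noteq> {}"
  obtain U where U: "A \<subseteq> (\<Union>i. U i)" "\<And>i. bounded (U i)" "\<And>i. diameter (U i) \<le> 1"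
    "(\<Sum>i. diam_gauge 0 (U i)) < ennreal 1"
    by (rule hausdorff_measure_zeroD[OF assms zero_less_one zero_less_one]) (rule that)
  obtain x where "x \<in> A" using ne by blast
  then have "x \<in> (\<Union>i. U i)" using U(1) by (rule subsetD[rotated])
  then obtain i where "x \<in> U i" by (rule UN_E)
  then have "1 \<le> diam_gauge 0 (U i)" by (auto simp: diam_gauge_def)
  also have "\<dots> \<le> (\<Sum>i. diam_gauge 0 (U i))"
    using sum_le_suminf[of "\<lambda>i. diam_gauge 0 (U i)" "{i}"] by (simp add: summableI)
  finally show False using U by simp
qed

lemma powr_enlarge:
  fixes d s e :: real
  assumes "0 \<le> d" "0 < s" "0 < e" "d < D"
  obtains r where "d < r" "r < D" "r powr s \<le> d powr s + e"
proof -
  have "((\<lambda>r. r powr s) \<longlongrightarrow> d powr s) (at_right d)"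
    using assms by (intro tendsto_powr2 tendsto_intros) (auto simp: eventually_at_filter)
  then have "eventually (\<lambda>r. r powr s < d powr s + e) (at_right d)"
    using assms by (intro order_tendstoD) auto
  moreover have "eventually (\<lambda>r. d < r) (at_right d)" by (simp add: eventually_at_right_less)
  moreover have "eventually (\<lambda>r. r < D) (at_right d)"
    using assms(4) by (auto simp: eventually_at_right_field intro: exI[of _ D])
  ultimately have "eventually (\<lambda>r. d < r \<and> r < D \<and> r powr s < d powr s + e) (at_right d)"
    by eventually_elim auto
  then obtain r where "d < r \<and> r < D \<and> r powr s < d powr s + e"
    using eventually_happens[of _ "at_right d"] by (auto simp: trivial_limit_at_right_real)
  then show thesis using that[of r] by auto
qed

text \<open>Replacing the diameters by slightly larger radii avoids singletons, whose diameter is \<open>0\<close>.\<close>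

lemma hausdorff_null_cover:
  assumes "hausdorff_measure s A = 0" "0 < s" "0 < \<delta>" "0 < \<epsilon>"
  obtains U r where "A \<subseteq> (\<Union>i. U i)" "\<And>i. bounded (U i)" "\<And>i. diameter (U i) < r i"
    "\<And>i. 0 < r i" "\<And>i. r i < \<delta>" "(\<Sum>i. ennreal (r i powr s)) < ennreal \<epsilon>"
proof -
  have half: "0 < \<delta> / 2" "0 < \<epsilon> / 2" using assms(3,4) by auto
  obtain U0 where U0: "A \<subseteq> (\<Union>i. U0 i)" "\<And>i. bounded (U0 i)" "\<And>i. diameter (U0 i) \<le> \<delta> / 2"
    "(\<Sum>i. diam_gauge s (U0 i)) < ennreal (\<epsilon> / 2)"
    by (rule hausdorff_measure_zeroD[OF assms(1) half]) (rule that)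
  have "\<exists>r. diameter (U0 i) < r \<and> r < \<delta> \<and> r powr s \<le> diameter (U0 i) powr s + \<epsilon> / 2 * (1/2) ^ Suc i" for i
  proof -
    have "0 \<le> diameter (U0 i)" "diameter (U0 i) < \<delta>" "0 < \<epsilon> / 2 * (1/2) ^ Suc i"
      using U0(2,3)[of i] diameter_ge_0 assms(3,4) by (auto intro: le_less_trans)
    then show ?thesis using powr_enlarge[OF _ assms(2)] by metis
  qed
  then obtain r where r: "\<And>i. diameter (U0 i) < r i" "\<And>i. r i < \<delta>"
    "\<And>i. r i powr s \<le> diameter (U0 i) powr s + \<epsilon> / 2 * (1/2) ^ Suc i" by metis
  have r0: "0 < r i" for i using r(1)[of i] diameter_ge_0[OF U0(2), of i] by linarith
  have "ennreal (r i powr s) \<le> diam_gauge s (U0 i) + ennreal (\<epsilon> / 2 * (1/2) ^ Suc i)" for i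
  proof -
    have "ennreal (r i powr s) \<le> ennreal (diameter (U0 i) powr s + \<epsilon> / 2 * (1/2) ^ Suc i)"
      using r(3) by (intro ennreal_leI)
    also have "\<dots> = ennreal (diameter (U0 i) powr s) + ennreal (\<epsilon> / 2 * (1/2) ^ Suc i)"
      using assms(4) by (intro ennreal_plus) auto
    also have "ennreal (diameter (U0 i) powr s) = diam_gauge s (U0 i)"
      using assms(2) by (simp add: diam_gauge_def)
    finally show ?thesis .
  qed
  then have "(\<Sum>i. ennreal (r i powr s)) \<le> (\<Sum>i. diam_gauge s (U0 i) + ennreal (\<epsilon> / 2 * (1/2) ^ Suc i))"
    by (intro suminf_le summableI)
  also have "\<dots> = (\<Sum>i. diam_gauge s (U0 i)) + (\<Sum>i. ennreal (\<epsilon> / 2 * (1/2) ^ Suc i))"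
    by (intro suminf_add[symmetric] summableI)
  also have "(\<Sum>i. ennreal (\<epsilon> / 2 * (1/2) ^ Suc i)) = ennreal (\<epsilon> / 2)"
    using sums_mult[OF power_half_series, of "\<epsilon> / 2"] assms(4) by (intro suminf_ennreal_eq) auto
  also have "(\<Sum>i. diam_gauge s (U0 i)) + ennreal (\<epsilon> / 2) < ennreal (\<epsilon> / 2) + ennreal (\<epsilon> / 2)"
    using U0(4) by (subst (1 2) add.commute) (auto intro: ennreal_add_left_cancel_less[THEN iffD2])
  also have "\<dots> = ennreal \<epsilon>" using assms(4) by (simp flip: ennreal_plus)
  finally show thesis using that U0(1,2) r(1,2) r0 by blast
qed

text \<open>The preimage of \<open>U\<close> is enclosed in a measurable \<open>F\<close> because
  the coding map and the covering sets come without measurability.\<close>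

theorem mass_distribution:
  fixes X :: "'b \<Rightarrow> 'a::metric_space"
  assumes M: "prob_space M" and X: "X ` space M \<subseteq> A" and C: "0 < C"
    and mass: "\<And>U r. \<lbrakk>bounded U; diameter U < r; 0 < r; r < \<delta>\<rbrakk> \<Longrightarrow>
       \<exists>F\<in>sets M. X -` U \<inter> space M \<subseteq> F \<and> measure M F \<le> C * r powr s"
    and \<delta>: "0 < \<delta>"
  shows "ereal s \<le> hausdorff_dim A"
proof (rule hausdorff_dim_geI, rule ccontr)
  interpret prob_space M by fact
  fix s' assume s': "0 \<le> s'" "hausdorff_measure s' A = 0" "\<not> ereal s \<le> ereal s'"
  have "A \<noteq> {}" using X not_empty by blast
  then have s0: "0 < s'" using s' hausdorff_measure_0_empty by (cases "s' = 0") auto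
  \<comment> \<open>Radii below 1 allow the exponent \<open>s\<close> of the mass bound to be
    lowered to \<open>s'\<close>; the bound \<open>1 / C\<close> then forces total mass below
    1.\<close>
  have mins: "0 < min \<delta> 1" "0 < 1 / C" using \<delta> C by auto
  obtain U r where U: "A \<subseteq> (\<Union>i. U i)" "\<And>i. bounded (U i)" "\<And>i. diameter (U i) < r i"
    "\<And>i. 0 < r i" "\<And>i. r i < min \<delta> 1" "(\<Sum>i. ennreal (r i powr s')) < ennreal (1 / C)"
    by (rule hausdorff_null_cover[OF s'(2) s0 mins]) (rule that)
  have "\<exists>F\<in>sets M. X -` U i \<inter> space M \<subseteq> F \<and> measure M F \<le> C * r i powr s" for i
    using U(5)[of i] by (intro mass U) auto
  then obtain F where F: "\<And>i. F i \<in> sets M" "\<And>i. X -` U i \<inter> space M \<subseteq> F i"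
    "\<And>i. measure M (F i) \<le> C * r i powr s" by metis
  have "space M \<subseteq> (\<Union>i. F i)"
  proof
    fix w assume w: "w \<in> space M"
    then have "X w \<in> (\<Union>i. U i)" using X U(1) by (meson image_eqI subsetD)
    then obtain i where "X w \<in> U i" by (rule UN_E)
    then have "w \<in> F i" using w by (intro subsetD[OF F(2)]) simp
    then show "w \<in> (\<Union>i. F i)" by (rule UN_I[OF UNIV_I])
  qed
  then have "1 \<le> emeasure M (\<Union>i. F i)"
    using emeasure_mono[of "space M" "\<Union>i. F i" M] F(1) emeasure_space_1 by auto
  also have "\<dots> \<le> (\<Sum>i. emeasure M (F i))" using F(1) by (intro emeasure_subadditive_countably) auto
  also have "\<dots> \<le> (\<Sum>i. ennreal C * ennreal (r i powr s'))"
  proof (intro suminf_le allI summableI)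
    fix i
    have "r i powr s \<le> r i powr s'"
      using U(4,5)[of i] s' by (intro powr_mono') auto
    then have "C * r i powr s \<le> C * r i powr s'" using C by simp
    then have "measure M (F i) \<le> C * r i powr s'" using F(3)[of i] by linarith
    then show "emeasure M (F i) \<le> ennreal C * ennreal (r i powr s')"
      using C by (simp add: emeasure_eq_measure ennreal_leI flip: ennreal_mult)
  qed
  also have "\<dots> = ennreal C * (\<Sum>i. ennreal (r i powr s'))" by simp
  also have "\<dots> < ennreal C * ennreal (1 / C)"
    using U(6) C by (intro ennreal_mult_strict_left_mono) auto
  also have "\<dots> = 1" using C by (simp flip: ennreal_mult)
  finally show False by simp
qed

subsection \<open>Cylinders of the beta-transformation\<close>

text \<open>
  \<open>{b..<e}\<close> is an initial part of a cylinder of order \<open>n\<close>, described through the orbits rather than through admissible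
  digit words. It is a full cylinder, i.e. the \<open>n\<close>-th iterate maps it onto \<open>{0..<1}\<close>, iff \<open>e = b + 1 / \<beta> ^ n\<close>.
\<close>

definition cyl :: "real \<Rightarrow> nat \<Rightarrow> real \<Rightarrow> real \<Rightarrow> bool" where
  "cyl \<beta> n b e \<longleftrightarrow> 0 \<le> b \<and> b < e \<and> e \<le> 1 \<and> (beta_map \<beta> ^^ n) b = 0 \<and>
     (\<forall>i\<le>n. \<forall>y\<in>{b..<e}. (beta_map \<beta> ^^ i) y = (beta_map \<beta> ^^ i) b + \<beta> ^ i * (y - b))"

abbreviation full :: "real \<Rightarrow> nat \<Rightarrow> real \<Rightarrow> bool" where
  "full \<beta> n a \<equiv> cyl \<beta> n a (a + 1 / \<beta> ^ n)"

locale beta_base =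
  fixes \<beta> :: real
  assumes gt1: "1 < \<beta>"
begin

lemma pos [simp]: "0 < \<beta>" "\<beta> > 0" "\<beta> \<noteq> 0" "0 < \<beta> ^ n" "0 \<le> \<beta>"
  using gt1 by auto

abbreviation T :: "nat \<Rightarrow> real \<Rightarrow> real" where
  "T n \<equiv> beta_map \<beta> ^^ n"

lemma T_Suc: "T (Suc n) x = \<beta> * T n x - of_int \<lfloor>\<beta> * T n x\<rfloor>"
  by (simp add: beta_map_def)

lemma T_add: "T (m + n) x = T n (T m x)"
  by (metis funpow_add add.commute comp_apply)

lemma T_nonneg: "0 \<le> x \<Longrightarrow> 0 \<le> T n x"
  by (cases n) (auto simp: beta_map_def)

lemma T_less_1: "0 \<le> x \<Longrightarrow> x < 1 \<Longrightarrow> T n x < 1"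
proof (cases n)
  case (Suc k) then show ?thesis using frac_lt_1[of "\<beta> * T k x"] by (simp add: T_Suc frac_def beta_map_def)
qed simp

lemma T_le: "0 \<le> x \<Longrightarrow> T n x \<le> \<beta> ^ n * x"
proof (induction n)
  case (Suc n)
  have "T (Suc n) x \<le> \<beta> * T n x" unfolding T_Suc using T_nonneg[OF Suc.prems, of n] by simp
  also have "\<dots> \<le> \<beta> * (\<beta> ^ n * x)" using Suc by (intro mult_left_mono) auto
  finally show ?case by simp
qed simp

text \<open>One step expands by at most \<beta>, so an orbit that is not small later cannot have
  been very small shortly before. All lower bounds for orbits inside blocks rest on this.\<close>

lemma T_ge:
  assumes "0 \<le> x" "i \<le> n"
  shows "T n x / \<beta> ^ (n - i) \<le> T i x"
proof -
  have "T n x = T (n - i) (T i x)" using T_add[of i "n - i" x] assms by simp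
  also have "\<dots> \<le> \<beta> ^ (n - i) * T i x" using T_le T_nonneg assms by blast
  finally show ?thesis by (simp add: field_simps)
qed

lemma T_small: "0 \<le> x \<Longrightarrow> \<beta> ^ n * x < 1 \<Longrightarrow> T n x = \<beta> ^ n * x"
proof (induction n)
  case (Suc n)
  have "1 * (\<beta> ^ n * x) \<le> \<beta> * (\<beta> ^ n * x)"
    using gt1 Suc.prems by (intro mult_right_mono) (auto intro: mult_nonneg_nonneg)
  moreover have "\<beta> * (\<beta> ^ n * x) < 1" using Suc.prems by (simp add: mult.assoc)
  ultimately have "\<beta> ^ n * x < 1" by linarith
  then have "T n x = \<beta> ^ n * x" using Suc by blast
  moreover have "0 \<le> \<beta> * (\<beta> ^ n * x)" "\<beta> * (\<beta> ^ n * x) < 1" using Suc.prems by (auto simp: mult.assoc)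
  ultimately show ?case by (simp add: T_Suc floor_eq_iff del: funpow.simps)
qed simp

lemma convergent_eq: "x - beta_convergent \<beta> n x = T n x / \<beta> ^ n"
proof (induction n)
  case (Suc n)
  have "beta_convergent \<beta> (Suc n) x
      = beta_convergent \<beta> n x + of_int \<lfloor>\<beta> * T n x\<rfloor> / \<beta> ^ Suc n"
    by (simp add: beta_convergent_def beta_digit_def)
  with Suc have "x - beta_convergent \<beta> (Suc n) x = T n x / \<beta> ^ n - of_int \<lfloor>\<beta> * T n x\<rfloor> / \<beta> ^ Suc n" by simp
  also have "\<dots> = T (Suc n) x / \<beta> ^ Suc n" unfolding T_Suc by (simp add: field_simps)
  finally show ?case .
qed (simp add: beta_convergent_def)

lemma W_set_iff:
  "x \<in> W_set \<beta> \<psi> \<longleftrightarrow> x \<in> {0..1} \<and> (\<exists>\<^sub>\<infinity>n. T n x < \<psi> n)"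
proof -
  have "\<bar>x - beta_convergent \<beta> n x\<bar> < \<psi> n / \<beta> ^ n \<longleftrightarrow> T n x < \<psi> n" if "0 \<le> x" for n
    using T_nonneg[OF that, of n] pos(4)[of n]
    by (simp add: convergent_eq abs_of_nonneg divide_strict_right_mono less_divide_eq divide_less_eq)
  then show ?thesis by (auto simp: W_set_def)
qed

lemma cylI:
  assumes "0 \<le> b" "b < e" "e \<le> 1" "T n b = 0"
    and "\<And>i y. i \<le> n \<Longrightarrow> y \<in> {b..<e} \<Longrightarrow> T i y = T i b + \<beta> ^ i * (y - b)"
  shows "cyl \<beta> n b e"
  using assms unfolding cyl_def by blast

lemma cyl_bounds: "cyl \<beta> n b e \<Longrightarrow> 0 \<le> b \<and> b < e \<and> e \<le> 1 \<and> T n b = 0"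
  unfolding cyl_def by blast

lemma cyl_T: "cyl \<beta> n b e \<Longrightarrow> y \<in> {b..<e} \<Longrightarrow> T n y = \<beta> ^ n * (y - b)"
  unfolding cyl_def by simp

lemma cyl_Ti: "cyl \<beta> n b e \<Longrightarrow> i \<le> n \<Longrightarrow> y \<in> {b..<e} \<Longrightarrow> T i y = T i b + \<beta> ^ i * (y - b)"
  unfolding cyl_def by blast

lemma cyl_width:
  assumes "cyl \<beta> n b e" "y \<in> {b..<e}" shows "y < b + 1 / \<beta> ^ n"
proof -
  have "T n y < 1" using assms cyl_bounds[OF assms(1)] by (intro T_less_1) auto
  then show ?thesis using cyl_T[OF assms] by (simp add: field_simps)
qed

lemma cyl_unique:
  assumes "cyl \<beta> n b e" "cyl \<beta> n b' e'" "y \<in> {b..<e}" "y \<in> {b'..<e'}" shows "b = b'"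
  using cyl_T[OF assms(1,3)] cyl_T[OF assms(2,4)] by simp

lemma cyl_convergent: "cyl \<beta> n b e \<Longrightarrow> y \<in> {b..<e} \<Longrightarrow> beta_convergent \<beta> n y = b"
  using convergent_eq[of y n] cyl_T[of n b e y] by simp

lemma cyl_0: "cyl \<beta> 0 0 1"
  by (intro cylI) auto

text \<open>Refining by one digit either gives a full cylinder or keeps the old right end
  \<open>e\<close>; the minimum records this dichotomy, from which \<open>covering\<close> is
  built.\<close>

lemma cyl_step:
  assumes "cyl \<beta> n b e" "x \<in> {b..<e}"
  obtains b' where "b \<le> b'" "b' \<le> x" "x < b' + 1 / \<beta> ^ Suc n"
    "cyl \<beta> (Suc n) b' (min e (b' + 1 / \<beta> ^ Suc n))"
proof -
  define d where "d = \<lfloor>\<beta> * T n x\<rfloor>"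
  define b' where "b' = b + of_int d / \<beta> ^ Suc n"
  have b: "0 \<le> b" "e \<le> 1" using cyl_bounds[OF assms(1)] by auto
  have d0: "0 \<le> d" using T_nonneg[of x n] assms b by (simp add: d_def)
  then have bb: "b \<le> b'" by (simp add: b'_def)
  have Tx: "\<beta> * T n x = \<beta> ^ Suc n * (x - b)" using cyl_T[OF assms] by simp
  have "of_int d \<le> \<beta> ^ Suc n * (x - b)" "\<beta> ^ Suc n * (x - b) < of_int d + 1"
    unfolding d_def Tx by linarith+
  then have x: "b' \<le> x" "x < b' + 1 / \<beta> ^ Suc n" by (auto simp: b'_def field_simps)
  have "T (Suc n) y = \<beta> ^ Suc n * (y - b')" if y: "y \<in> {b'..<min e (b' + 1 / \<beta> ^ Suc n)}" for y
  proof -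
    have 1: "\<beta> * T n y = \<beta> ^ Suc n * (y - b)" using cyl_T[OF assms(1), of y] y bb by auto
    have "of_int d \<le> \<beta> ^ Suc n * (y - b)" "\<beta> ^ Suc n * (y - b) < of_int d + 1"
      using y by (auto simp: b'_def field_simps)
    then have "\<lfloor>\<beta> * T n y\<rfloor> = d" unfolding 1 by linarith
    then have "T (Suc n) y = \<beta> ^ Suc n * (y - b) - of_int d" unfolding T_Suc 1 by simp
    also have "\<dots> = \<beta> ^ Suc n * (y - b')" by (simp add: b'_def field_simps)
    finally show ?thesis .
  qed
  note S = this
  have b'e: "b' < e" using x assms by auto
  have main: "T i y = T i b' + \<beta> ^ i * (y - b')"
    if "i \<le> Suc n" "y \<in> {b'..<min e (b' + 1 / \<beta> ^ Suc n)}" for i y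
  proof (cases "i = Suc n")
    case True then show ?thesis using S[OF that(2)] S[of b'] b'e by auto
  next
    case False
    then have "i \<le> n" using that by simp
    then show ?thesis
      using cyl_Ti[OF assms(1), of i y] cyl_Ti[OF assms(1), of i b'] that(2) bb b'e by (auto simp: algebra_simps)
  qed
  have T0: "T (Suc n) b' = 0" using S[of b'] b'e by auto
  have "cyl \<beta> (Suc n) b' (min e (b' + 1 / \<beta> ^ Suc n))"
    by (rule cylI[OF _ _ _ T0 main]) (use b bb b'e in auto)
  with that bb x show thesis by blast
qed

text \<open>
  A non-full cylinder always ends where some full cylinder of smaller order ends. This replaces the
  expansion of \<open>1\<close> in the usual description of the \<open>\<beta>\<close>-shift.
\<close>

lemma covering:
  assumes "x \<in> {0..<1}"
  obtains k a b where "k \<le> n" "full \<beta> k a" "a \<le> b" "x \<in> {b..<a + 1 / \<beta> ^ k}" "cyl \<beta> n b (a + 1 / \<beta> ^ k)"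
proof -
  have "\<exists>k a b. k \<le> n \<and> full \<beta> k a \<and> a \<le> b \<and> x \<in> {b..<a + 1 / \<beta> ^ k} \<and> cyl \<beta> n b (a + 1 / \<beta> ^ k)"
  proof (induction n)
    case 0 show ?case using cyl_0 assms by (intro exI[of _ 0]) auto
  next
    case (Suc n)
    then obtain k a b where *: "k \<le> n" "full \<beta> k a" "a \<le> b" "x \<in> {b..<a + 1 / \<beta> ^ k}"
      "cyl \<beta> n b (a + 1 / \<beta> ^ k)" by blast
    obtain b' where b': "b \<le> b'" "b' \<le> x" "x < b' + 1 / \<beta> ^ Suc n"
      "cyl \<beta> (Suc n) b' (min (a + 1 / \<beta> ^ k) (b' + 1 / \<beta> ^ Suc n))"
      using cyl_step[OF *(5,4)] by blast
    show ?case
    proof (cases "b' + 1 / \<beta> ^ Suc n \<le> a + 1 / \<beta> ^ k")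
      case True
      then show ?thesis using b' by (intro exI[of _ "Suc n"] exI[of _ b']) (auto simp: min_def split: if_splits)
    next
      case False
      then show ?thesis using b' * by (intro exI[of _ k] exI[of _ a] exI[of _ b']) (auto simp: min_def)
    qed
  qed
  with that show thesis by blast
qed

lemma full_bounds: "full \<beta> n a \<Longrightarrow> 0 \<le> a \<and> a + 1 / \<beta> ^ n \<le> 1 \<and> a < 1"
  using cyl_bounds[of n a "a + 1 / \<beta> ^ n"] by linarith

lemma full_spaced:
  assumes "full \<beta> n a" "full \<beta> n a'" "a < a'" shows "a + 1 / \<beta> ^ n \<le> a'"
proof (rule ccontr)
  assume "\<not> ?thesis"
  then have "a' \<in> {a..<a + 1 / \<beta> ^ n}" "a' \<in> {a'..<a' + 1 / \<beta> ^ n}" using assms by auto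
  from cyl_unique[OF assms(1,2) this] assms(3) show False by simp
qed

text \<open>The first cylinder need not be full: it suffices that the second one, shrunk by
  \<open>\<beta> ^ n\<close>, fits below \<open>e\<close>. \<open>special_word\<close> applies this
  to a word truncated at \<open>q\<close>, for which only an interval of length
  \<open>1 / \<beta> ^ m\<close> is available.\<close>

lemma cyl_append:
  assumes "cyl \<beta> n a e" "full \<beta> k b" "a + (b + 1 / \<beta> ^ k) / \<beta> ^ n \<le> e"
  shows "full \<beta> (n + k) (a + b / \<beta> ^ n)"
proof -
  let ?a = "a + b / \<beta> ^ n"
  have b: "0 \<le> b" using full_bounds[OF assms(2)] by simp
  have e: "?a + 1 / \<beta> ^ (n + k) \<le> e" using assms(3) by (simp add: power_add field_simps)
  have lt: "?a < ?a + 1 / \<beta> ^ (n + k)" by simp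
  have aa: "a \<le> ?a" using b by simp
  have in1: "y \<in> {a..<e}" if "y \<in> {?a..<?a + 1 / \<beta> ^ (n + k)}" for y using that e aa by auto
  have in2: "T n y \<in> {b..<b + 1 / \<beta> ^ k} \<and> T n y = \<beta> ^ n * (y - a)"
    if "y \<in> {?a..<?a + 1 / \<beta> ^ (n + k)}" for y
  proof -
    have y: "b / \<beta> ^ n \<le> y - a" "y - a < (b + 1 / \<beta> ^ k) / \<beta> ^ n"
      using that by (auto simp: power_add add_divide_distrib mult.commute)
    have "T n y = \<beta> ^ n * (y - a)" using cyl_T[OF assms(1) in1[OF that]] .
    moreover have "b \<le> (y - a) * \<beta> ^ n" using y(1) by (simp only: pos_divide_le_eq[OF pos(4)])
    moreover have "(y - a) * \<beta> ^ n < b + 1 / \<beta> ^ k" using y(2) by (simp only: pos_less_divide_eq[OF pos(4)])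
    ultimately show ?thesis by (simp add: mult.commute)
  qed
  have Tna: "T n ?a = b" using cyl_T[OF assms(1) in1[of ?a]] lt by simp
  have main: "T i y = T i ?a + \<beta> ^ i * (y - ?a)"
    if "i \<le> n + k" and y: "y \<in> {?a..<?a + 1 / \<beta> ^ (n + k)}" for i y
  proof (cases "i \<le> n")
    case True
    have "T i ?a = T i a + \<beta> ^ i * (?a - a)" using cyl_Ti[OF assms(1) True in1[of ?a]] lt by simp
    then show ?thesis using cyl_Ti[OF assms(1) True in1[OF y]] by (simp only: right_diff_distrib)
  next
    case False
    define j where "j = i - n"
    have j: "i = n + j" "j \<le> k" using that False by (auto simp: j_def)
    have t: "T n y - b = \<beta> ^ n * (y - ?a)" using in2[OF y] by (simp add: right_diff_distrib distrib_left)
    have ia: "T i ?a = T j b" by (simp only: j T_add Tna)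
    have "T i y = T j (T n y)" by (simp only: j T_add)
    also have "\<dots> = T j b + \<beta> ^ j * (T n y - b)" using cyl_Ti[OF assms(2) j(2)] in2[OF y] by blast
    also have "\<dots> = T i ?a + \<beta> ^ i * (y - ?a)"
      unfolding ia t by (simp add: j power_add)
    finally show ?thesis .
  qed
  have "T (n + k) ?a = 0" using cyl_bounds[OF assms(2)] by (simp only: T_add Tna)
  moreover have "0 \<le> ?a" "?a + 1 / \<beta> ^ (n + k) \<le> 1" using cyl_bounds[OF assms(1)] b e by auto
  ultimately show ?thesis using cylI[OF _ lt _ _ main] by blast
qed

lemma full_append:
  assumes "full \<beta> n a" "full \<beta> k b" shows "full \<beta> (n + k) (a + b / \<beta> ^ n)"
  using full_bounds[OF assms(2)] by (intro cyl_append[OF assms]) (simp add: divide_right_mono)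

lemma full_zero: "full \<beta> n 0"
proof -
  have 1: "1 / \<beta> ^ n \<le> 1" using gt1 by (simp add: one_le_power)
  have *: "T i y = \<beta> ^ i * y" if "i \<le> n" "y \<in> {0..<1 / \<beta> ^ n}" for i y
  proof -
    have "\<beta> ^ i * y \<le> \<beta> ^ n * y" using that gt1 by (intro mult_right_mono power_increasing) auto
    then show ?thesis using that by (intro T_small) (auto simp: field_simps)
  qed
  have T0: "T i 0 = 0" for i by (rule T_small[of 0 i, simplified])
  show ?thesis using 1 * by (intro cylI) (simp_all add: T0)
qed

lemma full_extend: "full \<beta> k a \<Longrightarrow> k \<le> n \<Longrightarrow> full \<beta> n a"
  using full_append[of k a "n - k" 0] full_zero by simp

text \<open>
  If there is no such word, then the cylinder of order \<open>n\<close> around each of the \<open>n + 2\<close> points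
  \<open>p + i / \<beta> ^ n\<close> has the same right endpoint as one of at most \<open>n + 1\<close> full cylinders around
  \<open>p\<close>, so two of the points share their cylinder, which is too short for that.
\<close>

lemma full_in_interval:
  assumes "0 \<le> p" "q \<le> 1" "(real n + 2) / \<beta> ^ n < q - p"
  shows "\<exists>a. full \<beta> n a \<and> p \<le> a \<and> a + 1 / \<beta> ^ n \<le> q"
proof (rule ccontr)
  assume "\<not> ?thesis"
  then have no: "\<not> (p \<le> a \<and> a + 1 / \<beta> ^ n \<le> q)" if "full \<beta> n a" for a using that by blast
  define h where "h = 1 / \<beta> ^ n"
  have h: "h > 0" "(real n + 2) * h < q - p" using assms by (auto simp: h_def)
  define x where "x i = p + real i * h" for i
  have xr: "x i \<in> {0..<1}" "p \<le> x i" "x i + h < q" if "i \<le> Suc n" for i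
  proof -
    have "real i * h \<le> (real n + 1) * h" using that h by (intro mult_right_mono) auto
    then have "x i + h \<le> p + (real n + 2) * h" by (simp add: x_def algebra_simps)
    then show "x i + h < q" using h by simp
    then show "x i \<in> {0..<1}" "p \<le> x i" using h assms by (auto simp: x_def)
  qed
  have "\<exists>k a b. k \<le> n \<and> full \<beta> k a \<and> a < p \<and> x i \<in> {b..<a + 1 / \<beta> ^ k} \<and> cyl \<beta> n b (a + 1 / \<beta> ^ k)"
    if i: "i \<le> Suc n" for i
  proof -
    obtain k a b where *: "k \<le> n" "full \<beta> k a" "a \<le> b" "x i \<in> {b..<a + 1 / \<beta> ^ k}" "cyl \<beta> n b (a + 1 / \<beta> ^ k)"
      using covering[OF xr(1)[OF i]] by metis
    have "a + 1 / \<beta> ^ k \<le> b + h"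
    proof (rule ccontr)
      assume "\<not> ?thesis"
      then have "b + h \<in> {b..<a + 1 / \<beta> ^ k}" using h by auto
      from cyl_width[OF *(5) this] show False by (simp add: h_def)
    qed
    then have "a + 1 / \<beta> ^ k < q" using * xr(3)[OF i] by auto
    moreover have "1 / \<beta> ^ n \<le> 1 / \<beta> ^ k" using *(1) gt1 by (intro divide_left_mono power_increasing) auto
    \<comment> \<open>Otherwise \<open>a\<close>, padded with zeros up to order \<open>n\<close>,
      would be a full word inside the interval.\<close>
    ultimately have "a < p" using no[OF full_extend[OF *(2,1)]] by auto
    with * show ?thesis by blast
  qed
  then obtain k a b where *: "\<And>i. i \<le> Suc n \<Longrightarrow> k i \<le> n \<and> full \<beta> (k i) (a i) \<and> a i < p \<and>
      x i \<in> {b i..<a i + 1 / \<beta> ^ k i} \<and> cyl \<beta> n (b i) (a i + 1 / \<beta> ^ k i)" by metis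
  have "\<not> inj_on k {..Suc n}"
  proof
    assume "inj_on k {..Suc n}"
    moreover have "k ` {..Suc n} \<subseteq> {..n}" using * by auto
    ultimately have "card {..Suc n} \<le> card {..n}" by (metis card_inj_on_le finite_atMost)
    then show False by simp
  qed
  then obtain i j where ij: "i \<le> Suc n" "j \<le> Suc n" "i < j" "k i = k j"
    unfolding inj_on_def by (metis atMost_iff linorder_neqE_nat)
  \<comment> \<open>Two full cylinders of the same order that both contain \<open>p\<close>: they
    start before it and reach beyond \<open>x i\<close> and \<open>x j\<close>.\<close>
  have "a i = a j"
    using cyl_unique[of "k i" "a i" "a i + 1 / \<beta> ^ k i" "a j" "a j + 1 / \<beta> ^ k i" p] *[OF ij(1)] *[OF ij(2)] ij
     xr(2)[OF ij(1)] xr(2)[OF ij(2)] by auto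
  define e where "e = a i + 1 / \<beta> ^ k i"
  have 1: "cyl \<beta> n (b i) e" "x i \<in> {b i..<e}" "cyl \<beta> n (b j) e" "x j \<in> {b j..<e}"
    using *[OF ij(1)] *[OF ij(2)] \<open>a i = a j\<close> ij(4) by (auto simp: e_def)
  \<comment> \<open>Both cylinders end at \<open>e\<close>, so the larger left endpoint lies in both
    of them.\<close>
  then have "b i = b j" using cyl_unique[OF 1(1,3), of "max (b i) (b j)"] by auto
  then have "x j < b i + h" using cyl_width[OF 1(3,4)] by (simp add: h_def)
  also have "\<dots> \<le> x i + h" using 1 by auto
  also have "\<dots> \<le> x j"
    using ij(3) h(1) mult_right_mono[of "real i + 1" "real j" h] by (simp add: x_def algebra_simps)
  finally show False by simp
qed

section \<open>Counting full words and convergents\<close>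

lemma full_finite_card: "finite {a. full \<beta> n a}" "real (card {a. full \<beta> n a}) \<le> \<beta> ^ n"
proof -
  let ?g = "\<lambda>a. \<lfloor>a * \<beta> ^ n\<rfloor>"
  have inj: "inj_on ?g {a. full \<beta> n a}"
  proof (rule inj_onI, rule ccontr)
    have *: False if "full \<beta> n x" "full \<beta> n y" "?g x = ?g y" "x < y" for x y
    proof -
      have "x + 1 / \<beta> ^ n \<le> y" using full_spaced that by blast
      then have "x * \<beta> ^ n + 1 \<le> y * \<beta> ^ n" by (simp add: field_simps)
      then show False using that(3) by linarith
    qed
    fix x y assume "x \<in> {a. full \<beta> n a}" "y \<in> {a. full \<beta> n a}" "?g x = ?g y" "x \<noteq> y"
    then show False using *[of x y] *[of y x] by (cases "x < y") auto
  qed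
  have sub: "?g ` {a. full \<beta> n a} \<subseteq> {0..<\<lfloor>\<beta> ^ n\<rfloor>}"
  proof safe
    fix a assume a: "full \<beta> n a"
    have "a * \<beta> ^ n + 1 \<le> \<beta> ^ n" using full_bounds[OF a] by (simp add: field_simps)
    then show "\<lfloor>a * \<beta> ^ n\<rfloor> \<in> {0..<\<lfloor>\<beta> ^ n\<rfloor>}" using full_bounds[OF a] by (auto simp: le_floor_iff) linarith
  qed
  show fin: "finite {a. full \<beta> n a}" using finite_imageD[OF finite_subset[OF sub] inj] by simp
  have "card {a. full \<beta> n a} \<le> card {0..<\<lfloor>\<beta> ^ n\<rfloor>}" using card_inj_on_le[OF inj sub] by simp
  also have "\<dots> = nat \<lfloor>\<beta> ^ n\<rfloor>" by simp
  finally have "real (card {a. full \<beta> n a}) \<le> real (nat \<lfloor>\<beta> ^ n\<rfloor>)" by linarith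
  also have "\<dots> \<le> \<beta> ^ n" using pos(4)[of n] by linarith
  finally show "real (card {a. full \<beta> n a}) \<le> \<beta> ^ n" .
qed

text \<open>By \<open>full_in_interval\<close>, each of about
  \<open>\<beta> ^ n / (real n + 3)\<close> disjoint intervals of length \<open>h\<close> contains a
  full word. Taking \<open>n + 3\<close> in place of \<open>n + 2\<close> supplies the strict
  inequality required there.\<close>

lemma full_card_ge: "\<beta> ^ n / (real n + 3) - 1 \<le> real (card {a. full \<beta> n a})"
proof -
  define N where "N = nat \<lfloor>\<beta> ^ n / (real n + 3)\<rfloor>"
  have fl: "0 \<le> \<lfloor>\<beta> ^ n / (real n + 3)\<rfloor>" by simp
  have N: "\<beta> ^ n / (real n + 3) - 1 \<le> real N" "real N \<le> \<beta> ^ n / (real n + 3)"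
    using fl unfolding N_def by linarith+
  define h where "h = (real n + 3) / \<beta> ^ n"
  have h: "h > 0" "(real n + 2) / \<beta> ^ n < h" "real N * h \<le> 1" using N(2) by (auto simp: h_def divide_strict_right_mono field_simps)
  have "\<exists>a. full \<beta> n a \<and> real i * h \<le> a \<and> a < (real i + 1) * h" if "i < N" for i
  proof -
    have "(real i + 1) * h \<le> real N * h" using that h by (intro mult_right_mono) auto
    then obtain a where "full \<beta> n a" "real i * h \<le> a" "a + 1 / \<beta> ^ n \<le> (real i + 1) * h"
      using full_in_interval[of "real i * h" "(real i + 1) * h" n] h by (auto simp: algebra_simps)
    moreover have "0 < 1 / \<beta> ^ n" by simp
    ultimately show ?thesis by (intro exI[of _ a]) linarith
  qed
  then obtain f where f: "\<And>i. i < N \<Longrightarrow> full \<beta> n (f i) \<and> real i * h \<le> f i \<and> f i < (real i + 1) * h" by metis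
  have "inj_on f {..<N}"
  proof (rule inj_onI)
    fix i j assume "i \<in> {..<N}" "j \<in> {..<N}" "f i = f j"
    then have "real i * h < (real j + 1) * h" "real j * h < (real i + 1) * h" using f[of i] f[of j] by auto
    then show "i = j" using h(1) by (simp add: mult_less_cancel_right)
  qed
  then have "card {..<N} \<le> card {a. full \<beta> n a}"
    using f by (intro card_inj_on_le[of f] full_finite_card) auto
  then show ?thesis using N by simp
qed

text \<open>By \<open>covering\<close>, a cylinder of order \<open>n\<close> shares its right end
  with a full cylinder of order \<open>k \<le> n\<close>, and that right end determines it. Summing
  \<open>\<beta> ^ k\<close> over \<open>k \<le> n\<close> gives the bound; the additional 1
  accounts for \<open>x = 1\<close>, which lies in no half-open cylinder.\<close>

lemma convergents_card:
  "finite (beta_convergent \<beta> n ` {0..1})"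
  "real (card (beta_convergent \<beta> n ` {0..1})) \<le> (real n + 1) * \<beta> ^ n + 1"
proof -
  let ?F = "SIGMA k:{..n}. {a. full \<beta> k a}"
  define P where "P b s \<longleftrightarrow> s \<in> ?F \<and> cyl \<beta> n b (snd s + 1 / \<beta> ^ fst s)" for b s
  have ex: "\<exists>s. P b s" if b: "b \<in> beta_convergent \<beta> n ` {0..<1}" for b
  proof -
    obtain x where x: "x \<in> {0..<1}" "b = beta_convergent \<beta> n x" using b by blast
    obtain k a b' where *: "k \<le> n" "full \<beta> k a" "a \<le> b'" "x \<in> {b'..<a + 1 / \<beta> ^ k}" "cyl \<beta> n b' (a + 1 / \<beta> ^ k)"
      using covering[OF x(1)] by metis
    then show ?thesis using cyl_convergent[OF *(5,4)] x by (auto simp: P_def intro!: exI[of _ "(k,a)"])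
  qed
  define g where "g b = (SOME s. P b s)" for b
  have g: "P b (g b)" if "b \<in> beta_convergent \<beta> n ` {0..<1}" for b
    unfolding g_def using someI_ex[OF ex[OF that]] .
  have inj: "inj_on g (beta_convergent \<beta> n ` {0..<1})"
  proof (rule inj_onI)
    fix b b' assume b: "b \<in> beta_convergent \<beta> n ` {0..<1}" "b' \<in> beta_convergent \<beta> n ` {0..<1}" "g b = g b'"
    let ?e = "snd (g b) + 1 / \<beta> ^ fst (g b)"
    have *: "cyl \<beta> n b ?e" "cyl \<beta> n b' ?e" using g[OF b(1)] g[OF b(2)] b(3) by (auto simp: P_def)
    then have "b < ?e" "b' < ?e" using cyl_bounds by blast+
    then show "b = b'" using cyl_unique[OF *, of "max b b'"] by auto
  qed
  have finF: "finite ?F" using full_finite_card(1) by auto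
  have sub: "g ` (beta_convergent \<beta> n ` {0..<1}) \<subseteq> ?F" using g by (force simp: P_def)
  have fin1: "finite (beta_convergent \<beta> n ` {0..<1})" using finite_imageD[OF finite_subset[OF sub finF] inj] .
  have "card (beta_convergent \<beta> n ` {0..<1}) \<le> card ?F" using card_inj_on_le[OF inj sub finF] .
  also have "card ?F = (\<Sum>k\<le>n. card {a. full \<beta> k a})" using full_finite_card(1) by (simp add: card_SigmaI)
  finally have "real (card (beta_convergent \<beta> n ` {0..<1})) \<le> (\<Sum>k\<le>n. real (card {a. full \<beta> k a}))"
    by (metis of_nat_mono of_nat_sum)
  also have "\<dots> \<le> (\<Sum>k\<le>n. \<beta> ^ n)"
    using full_finite_card(2) gt1 by (intro sum_mono order_trans[OF full_finite_card(2)] power_increasing) auto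
  also have "\<dots> = (real n + 1) * \<beta> ^ n" by (simp add: add.commute)
  finally have 1: "real (card (beta_convergent \<beta> n ` {0..<1})) \<le> (real n + 1) * \<beta> ^ n" .
  have eq: "beta_convergent \<beta> n ` {0..1} = insert (beta_convergent \<beta> n 1) (beta_convergent \<beta> n ` {0..<1})"
    by (auto simp: less_le)
  show "finite (beta_convergent \<beta> n ` {0..1})" unfolding eq using fin1 by simp
  show "real (card (beta_convergent \<beta> n ` {0..1})) \<le> (real n + 1) * \<beta> ^ n + 1"
    unfolding eq using 1 fin1 by (auto simp: card_insert_if)
qed

end

subsection \<open>Upper bounds\<close>

text \<open>Balls of radius \<open>\<psi> n / \<beta> ^ n\<close> around the convergents of all
  large orders cover the set. About \<open>n * \<beta> ^ n\<close> balls with diameters of order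
  \<open>\<beta> powr (- (1 + A) * n)\<close> contribute a term of order \<open>n * q ^ n\<close>,
  and \<open>1 < s * (1 + A)\<close> says exactly that \<open>q < 1\<close>.\<close>

lemma null_convergent_approx:
  fixes \<psi> :: "nat \<Rightarrow> real"
  assumes \<beta>: "1 < \<beta>" and psi: "\<And>n. 0 < n \<Longrightarrow> 0 < \<psi> n" and lim: "\<psi> \<longlonglongrightarrow> 0"
    and A: "ereal A < lower_order \<beta> \<psi>" and s: "0 < s" "1 < s * (1 + A)" and X: "X \<subseteq> W_set \<beta> \<psi>"
  shows "hausdorff_measure s X = 0"
proof (rule hausdorff_measure_zeroI)
  interpret beta_base \<beta> by unfold_locales fact
  fix \<delta> \<epsilon> :: real assume \<delta>: "0 < \<delta>" and \<epsilon>: "0 < \<epsilon>"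
  define q where "q = \<beta> powr (1 - s * (1 + A))"
  define f where "f n = 2 powr s * ((real n + 2) * q ^ n)" for n
  define \<rho> where "\<rho> n = 2 * \<psi> n / \<beta> ^ n" for n
  have q: "0 < q" "q < 1" using \<beta> s powr_less_mono[of "1 - s * (1 + A)" 0 \<beta>] by (auto simp: q_def)
  have "summable (\<lambda>n. real n * q ^ n)"
  proof -
    have "summable (\<lambda>n. diffs (\<lambda>_. 1) n * q ^ n)"
      using q by (intro termdiff_converges[of q 1]) (auto intro: summable_geometric)
    then have "summable (\<lambda>n. real (Suc n) * q ^ n)" by (simp add: diffs_def)
    from summable_diff[OF this summable_geometric[of q]] q show ?thesis by (simp add: algebra_simps)
  qed
  then have "summable (\<lambda>n. real n * q ^ n + 2 * q ^ n)"
    using q by (intro summable_add summable_mult summable_geometric) auto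
  then have sumf: "summable f" unfolding f_def by (intro summable_mult) (simp add: distrib_right)
  have f0: "0 \<le> f n" for n using q by (simp add: f_def)
  have "eventually (\<lambda>n. ereal A < ereal (- log \<beta> (\<psi> n) / real n)) sequentially"
    using A unfolding lower_order_def by (rule less_LiminfD)
  then have "eventually (\<lambda>n. ((real n + 1) * \<beta> ^ n + 1) * \<rho> n powr s \<le> f n) sequentially"
    using eventually_gt_at_top[of 0]
  proof eventually_elim
    case (elim n)
    have "A * real n < - log \<beta> (\<psi> n)" using elim by (simp add: field_simps)
    then have "log \<beta> (\<psi> n) < - A * real n" by simp
    then have "\<psi> n < \<beta> powr (- A * real n)"
      using less_powr_iff[of \<beta> "\<psi> n" "- A * real n"] \<beta> psi[of n] elim by simp
    then have "\<rho> n \<le> 2 * \<beta> powr (- A * real n) / \<beta> powr real n"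
      using \<beta> by (simp add: \<rho>_def powr_realpow divide_right_mono)
    also have "\<dots> = 2 * \<beta> powr (- (1 + A) * real n)"
    proof -
      have "- (1 + A) * real n = - A * real n - real n" by (simp add: algebra_simps)
      then show ?thesis by (simp add: powr_diff)
    qed
    finally have "\<rho> n powr s \<le> (2 * \<beta> powr (- (1 + A) * real n)) powr s"
      using s psi[of n] elim by (intro powr_mono2) (auto simp: \<rho>_def)
    also have "\<dots> = 2 powr s * \<beta> powr (- s * (1 + A) * real n)"
    proof -
      have "- (1 + A) * real n * s = - s * (1 + A) * real n" by (simp add: algebra_simps)
      then show ?thesis by (simp add: powr_mult powr_powr)
    qed
    finally have 1: "\<rho> n powr s \<le> 2 powr s * \<beta> powr (- s * (1 + A) * real n)" .
    have "1 \<le> \<beta> ^ n" using \<beta> by (simp add: one_le_power)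
    then have "(real n + 1) * \<beta> ^ n + 1 \<le> (real n + 2) * \<beta> powr real n"
      using \<beta> by (simp add: powr_realpow algebra_simps)
    with 1 have "((real n + 1) * \<beta> ^ n + 1) * \<rho> n powr s
        \<le> ((real n + 2) * \<beta> powr real n) * (2 powr s * \<beta> powr (- s * (1 + A) * real n))"
      by (intro mult_mono) auto
    also have "\<dots> = 2 powr s * ((real n + 2) * (\<beta> powr real n * \<beta> powr (- s * (1 + A) * real n)))"
      by (simp only: ac_simps)
    also have "\<beta> powr real n * \<beta> powr (- s * (1 + A) * real n) = q ^ n"
      using \<beta> by (simp add: q_def powr_add[symmetric] powr_powr algebra_simps flip: powr_realpow)
    finally show ?case by (simp add: f_def)
  qed
  moreover have "\<rho> \<longlonglongrightarrow> 0"
  proof -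
    have "(\<lambda>n. 2 * \<psi> n * (1 / \<beta>) ^ n) \<longlonglongrightarrow> 2 * 0 * 0"
      using \<beta> by (intro tendsto_intros lim LIMSEQ_power_zero) auto
    then show ?thesis by (simp add: \<rho>_def[abs_def] power_divide)
  qed
  then have "eventually (\<lambda>n. \<rho> n < \<delta>) sequentially" using \<delta> by (rule order_tendstoD)
  ultimately have "eventually (\<lambda>n. ((real n + 1) * \<beta> ^ n + 1) * \<rho> n powr s \<le> f n \<and> \<rho> n < \<delta>) sequentially"
    by eventually_elim auto
  then obtain N1 where N1: "\<And>n. n \<ge> N1 \<Longrightarrow> ((real n + 1) * \<beta> ^ n + 1) * \<rho> n powr s \<le> f n \<and> \<rho> n < \<delta>"
    by (auto simp: eventually_at_top_linorder)
  obtain N2 where N2: "\<And>n. n \<ge> N2 \<Longrightarrow> norm (\<Sum>i. f (i + n)) < \<epsilon>"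
    using suminf_exist_split[OF \<epsilon> sumf] by blast
  \<comment> \<open>\<open>Suc\<close> keeps every index positive, since nothing is known about the
    sign of \<open>\<psi> 0\<close>.\<close>
  define N where "N = Suc (max N1 N2)"
  have NN: "N1 \<le> n + N" "N2 \<le> N" for n by (auto simp: N_def)
  define G where "G n = (\<lambda>w. cball w (\<psi> (n + N) / \<beta> ^ (n + N))) ` (beta_convergent \<beta> (n + N) ` {0..1})" for n
  show "hausdorff_content s \<delta> X \<le> ennreal \<epsilon>"
  proof (rule hausdorff_content_le_levels[where G = G and \<rho> = "\<lambda>n. \<rho> (n + N)"])
    show "X \<subseteq> (\<Union>n. \<Union> (G n))"
    proof
      fix x assume "x \<in> X"
      then have x: "x \<in> {0..1}" "\<exists>\<^sub>\<infinity>n. \<bar>x - beta_convergent \<beta> n x\<bar> < \<psi> n / \<beta> ^ n"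
        using X by (auto simp: W_set_def)
      then obtain n where n: "n \<ge> N" "\<bar>x - beta_convergent \<beta> n x\<bar> < \<psi> n / \<beta> ^ n"
        by (auto simp: INFM_nat_le)
      then obtain m where m: "n = m + N" by (metis add.commute le_Suc_ex)
      have "x \<in> cball (beta_convergent \<beta> n x) (\<psi> n / \<beta> ^ n)"
        using n by (simp add: dist_real_def abs_minus_commute)
      moreover have "cball (beta_convergent \<beta> n x) (\<psi> n / \<beta> ^ n) \<in> G m" using x(1) by (auto simp: G_def m)
      ultimately show "x \<in> (\<Union>n. \<Union> (G n))" by blast
    qed
    show "finite (G n)" for n using convergents_card(1) by (simp add: G_def)
    have ps: "0 < \<psi> (n + N)" for n by (intro psi) (simp add: N_def)
    show r0: "0 \<le> \<rho> (n + N)" for n using ps[of n] by (simp add: \<rho>_def)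
    show "\<rho> (n + N) \<le> \<delta>" for n using N1[OF NN(1), of n] by linarith
    show "bounded U \<and> diameter U \<le> \<rho> (n + N)" if U: "U \<in> G n" for U n
    proof -
      obtain w where "U = cball w (\<psi> (n + N) / \<beta> ^ (n + N))" using U by (auto simp: G_def)
      moreover have "0 \<le> \<psi> (n + N) / \<beta> ^ (n + N)" using ps[of n] by simp
      ultimately show ?thesis by (simp add: \<rho>_def)
    qed
    have "(\<Sum>n. ennreal (real (card (G n)) * \<rho> (n + N) powr s)) \<le> (\<Sum>n. ennreal (f (n + N)))"
    proof (intro suminf_le allI summableI ennreal_leI)
      fix n
      have "card (G n) \<le> card (beta_convergent \<beta> (n + N) ` {0..1})"
        unfolding G_def by (intro card_image_le convergents_card)
      then have "real (card (G n)) \<le> (real (n + N) + 1) * \<beta> ^ (n + N) + 1"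
        using convergents_card(2)[of "n + N"] by linarith
      then have "real (card (G n)) * \<rho> (n + N) powr s \<le> ((real (n + N) + 1) * \<beta> ^ (n + N) + 1) * \<rho> (n + N) powr s"
        by (intro mult_right_mono) auto
      also have "\<dots> \<le> f (n + N)" using N1[OF NN(1)] by blast
      finally show "real (card (G n)) * \<rho> (n + N) powr s \<le> f (n + N)" .
    qed
    also have "\<dots> = ennreal (\<Sum>n. f (n + N))"
      using f0 sumf by (intro suminf_ennreal2) (auto simp: summable_iff_shift)
    also have "\<dots> \<le> ennreal \<epsilon>" using N2[OF NN(2)] by (intro ennreal_leI) simp
    finally show "(\<Sum>n. ennreal (real (card (G n)) * \<rho> (n + N) powr s)) \<le> ennreal \<epsilon>" .
  qed (rule s)
qed

lemma lower_order_nonneg: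
  fixes \<psi> :: "nat \<Rightarrow> real"
  assumes \<beta>: "1 < \<beta>" and pos: "\<And>n. 0 < n \<Longrightarrow> 0 < \<psi> n" and lim: "\<psi> \<longlonglongrightarrow> 0"
  shows "0 \<le> lower_order \<beta> \<psi>"
  unfolding lower_order_def
proof (rule Liminf_bounded)
  have "eventually (\<lambda>n. \<psi> n < 1) sequentially" using lim by (rule order_tendstoD) simp
  then show "eventually (\<lambda>n. 0 \<le> ereal (- log \<beta> (\<psi> n) / real n)) sequentially"
    using eventually_gt_at_top[of 0]
  proof eventually_elim
    case (elim n)
    then have "log \<beta> (\<psi> n) \<le> 0" using \<beta> pos by (subst log_le_zero_cancel_iff) auto
    then show ?case by (simp add: divide_nonpos_nonneg)
  qed
qed

lemma E_set_dim_le: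
  fixes \<psi> :: "nat \<Rightarrow> real"
  assumes \<beta>: "1 < \<beta>" and pos: "\<And>n. 0 < n \<Longrightarrow> 0 < \<psi> n" and lim: "\<psi> \<longlonglongrightarrow> 0"
  shows "hausdorff_dim (E_set \<beta> \<psi>) \<le> 1 / (1 + lower_order \<beta> \<psi>)"
proof (rule ccontr)
  assume "\<not> ?thesis"
  then obtain s where s: "1 / (1 + lower_order \<beta> \<psi>) < ereal s" "ereal s < hausdorff_dim (E_set \<beta> \<psi>)"
    using ereal_dense2[of "1 / (1 + lower_order \<beta> \<psi>)" "hausdorff_dim (E_set \<beta> \<psi>)"] by (auto simp: not_le)
  have nn: "0 \<le> lower_order \<beta> \<psi>" using lower_order_nonneg[OF assms] .
  obtain A where A: "0 < s" "ereal A < lower_order \<beta> \<psi>" "1 < s * (1 + A)"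
  proof (cases "lower_order \<beta> \<psi>")
    case (real r)
    then have r: "0 \<le> r" "1 / (1 + r) < s" using nn s(1) by (auto simp: one_ereal_def)
    have "0 < 1 / (1 + r)" using r by simp
    then have s0: "0 < s" using r by linarith
    then have "1 / s - 1 < r" using r by (simp add: field_simps)
    then obtain A where "1 / s - 1 < A" "A < r" using dense by blast
    then show thesis using that[of A] s0 real by (simp add: field_simps)
  next
    case PInf
    then have "0 < s" using s(1) by simp
    \<comment> \<open>Every real \<open>A\<close> lies below the infinite order;
      \<open>1 / s\<close> makes \<open>s * (1 + A)\<close> equal to \<open>s + 1\<close>.\<close>
    then show thesis using that[of "1 / s"] PInf by (simp add: field_simps)
  qed (use nn in auto)
  have "hausdorff_measure s (E_set \<beta> \<psi>) = 0"
    using null_convergent_approx[OF \<beta> pos lim A(2,1,3)] by (auto simp: E_set_def)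
  then have "hausdorff_dim (E_set \<beta> \<psi>) \<le> ereal s" using A by (intro hausdorff_dim_le) auto
  then show False using s(2) by simp
qed

text \<open>Each set of a cover of \<open>E\<close> is multiplied by a grid of cubes of side
  \<open>r k\<close> in the other coordinates. At most \<open>(2 / r k) powr (D - 1)\<close> cubes,
  each costing \<open>(D * r k) powr (D - 1 + s)\<close>, leave \<open>C * r k powr s\<close> in
  total.\<close>

lemma null_cylinder_set:
  fixes i :: "'d::finite" and E :: "real set"
  assumes E: "hausdorff_measure s E = 0" "0 < s"
    and Q: "Q \<subseteq> {x :: real ^ 'd. x $ i \<in> E \<and> (\<forall>j. x $ j \<in> {0..1})}"
  shows "hausdorff_measure (real CARD('d) - 1 + s) Q = 0"
proof (rule hausdorff_measure_zeroI)
  fix \<delta> \<epsilon> :: real assume \<delta>: "0 < \<delta>" and \<epsilon>: "0 < \<epsilon>"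
  define D where "D = real CARD('d)"
  have D1: "1 \<le> D" using zero_less_card_finite[where 'a='d] unfolding D_def by linarith
  define C where "C = 2 powr (D - 1) * D powr (D - 1 + s)"
  have C: "0 < C" using D1 by (simp add: C_def)
  \<comment> \<open>\<open>r k < 1\<close> yields \<open>M k \<le> 2 / r k\<close>, and
    \<open>r k < \<delta> / D\<close> keeps the diameters of the boxes below \<delta>.\<close>
  have pos: "0 < min 1 (\<delta> / D)" "0 < \<epsilon> / C" using \<delta> \<epsilon> C D1 by auto
  obtain U r where U: "E \<subseteq> (\<Union>k. U k)" "\<And>k. bounded (U k)" "\<And>k. diameter (U k) < r k"
    "\<And>k. 0 < r k" "\<And>k::nat. r k < min 1 (\<delta> / D)" "(\<Sum>k. ennreal (r k powr s)) < ennreal (\<epsilon> / C)"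
    by (rule hausdorff_null_cover[OF E pos]) (rule that)
  define M where "M k = nat \<lfloor>1 / r k\<rfloor> + 1" for k
  \<comment> \<open>Coordinate \<open>i\<close> carries the dummy index 0, as it is already confined
    to \<open>U k\<close>.\<close>
  define I where "I k = PiE UNIV (\<lambda>j. if j = i then {0::nat} else {..<M k})" for k
  define S where "S k p = {x :: real ^ 'd. x $ i \<in> U k \<and>
     (\<forall>j. j \<noteq> i \<longrightarrow> real (p j) * r k \<le> x $ j \<and> x $ j \<le> (real (p j) + 1) * r k)}" for k p
  have finI: "finite (I k)" for k by (auto simp: I_def intro!: finite_PiE)
  have cardI: "real (card (I k)) \<le> (2 / r k) powr (D - 1)" for k
  proof -
    have "card (I k) = (\<Prod>j\<in>UNIV. if j = i then 1 else M k)"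
      by (simp add: I_def card_PiE if_distrib cong: if_cong)
    also have "\<dots> = (\<Prod>j\<in>UNIV - {i}. M k)"
      by (subst prod.remove[of UNIV i]) (auto intro!: prod.cong)
    also have "\<dots> = M k ^ (CARD('d) - 1)" by (simp add: card_Diff_singleton)
    finally have "real (card (I k)) = real (M k) ^ (CARD('d) - 1)" by simp
    also have "\<dots> \<le> (2 / r k) ^ (CARD('d) - 1)"
    proof (intro power_mono)
      have "0 < 1 / r k" "1 \<le> 1 / r k" using U(4,5)[of k] by (auto simp: field_simps)
      then have "real (M k) \<le> 1 / r k + 1" unfolding M_def by linarith
      then show "real (M k) \<le> 2 / r k" using \<open>1 \<le> 1 / r k\<close> by simp
    qed simp
    also have "\<dots> = (2 / r k) powr (D - 1)"
    proof -
      have "D - 1 = real (CARD('d) - 1)" using D1 by (simp add: D_def of_nat_diff)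
      then show ?thesis using U(4)[of k] by (simp only:) (subst powr_realpow, auto)
    qed
    finally show ?thesis .
  qed
  have dist_S: "dist x y \<le> D * r k" if "x \<in> S k p" "y \<in> S k p" for x y k p
  proof -
    have "\<bar>x $ j - y $ j\<bar> \<le> r k" for j
    proof (cases "j = i")
      case True
      have "dist (x $ i) (y $ i) \<le> diameter (U k)"
        using that by (intro diameter_bounded_bound U) (auto simp: S_def)
      then show ?thesis using U(3)[of k] True by (simp add: dist_real_def)
    next
      case False
      then have "real (p j) * r k \<le> x $ j \<and> x $ j \<le> (real (p j) + 1) * r k"
        "real (p j) * r k \<le> y $ j \<and> y $ j \<le> (real (p j) + 1) * r k" using that by (auto simp: S_def)
      then show ?thesis unfolding distrib_right abs_le_iff by linarith
    qed
    then have "(\<Sum>j\<in>UNIV. \<bar>(x - y) $ j\<bar>) \<le> (\<Sum>j\<in>(UNIV::'d set). r k)" by (intro sum_mono) simp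
    then have "norm (x - y) \<le> (\<Sum>j\<in>(UNIV::'d set). r k)" using norm_le_l1_cart order_trans by blast
    then show ?thesis by (simp add: dist_norm D_def)
  qed
  show "hausdorff_content (real CARD('d) - 1 + s) \<delta> Q \<le> ennreal \<epsilon>"
  proof (rule hausdorff_content_le_levels[where G = "\<lambda>k. S k ` I k" and \<rho> = "\<lambda>k. D * r k"])
    show "0 < real CARD('d) - 1 + s" using D1[unfolded D_def] E(2) by linarith
    show "finite (S k ` I k)" for k using finI by simp
    show "0 \<le> D * r k" for k using D1 U(4)[of k] by simp
    show "D * r k \<le> \<delta>" for k using D1 U(5)[of k] by (simp add: field_simps)
    show "bounded V \<and> diameter V \<le> D * r k" if V: "V \<in> S k ` I k" for k V
    proof
      have *: "dist x y \<le> D * r k" if "x \<in> V" "y \<in> V" for x y using V that dist_S by blast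
      then show "bounded V" unfolding bounded_def by (metis (no_types) all_not_in_conv)
      show "diameter V \<le> D * r k"
        using * D1 U(4)[of k] by (intro diameter_le) (auto simp: dist_norm)
    qed
    show "Q \<subseteq> (\<Union>k. \<Union> (S k ` I k))"
    proof
      fix x assume "x \<in> Q"
      then have x: "x $ i \<in> E" "\<And>j. 0 \<le> x $ j" "\<And>j. x $ j \<le> 1" using Q by auto
      have "x $ i \<in> (\<Union>k. U k)" using x(1) U(1) by (rule subsetD[rotated])
      then obtain k where k: "x $ i \<in> U k" by (rule UN_E)
      define p where "p j = (if j = i then 0 else nat \<lfloor>x $ j / r k\<rfloor>)" for j
      have r: "0 < r k" using U(4) .
      have "p j < M k" for j
      proof -
        have "\<lfloor>x $ j / r k\<rfloor> \<le> \<lfloor>1 / r k\<rfloor>" using x(3)[of j] r by (intro floor_mono divide_right_mono) auto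
        then have "nat \<lfloor>x $ j / r k\<rfloor> \<le> nat \<lfloor>1 / r k\<rfloor>" by (rule nat_mono)
        then show ?thesis by (simp add: p_def M_def)
      qed
      moreover have "p i = 0" by (simp add: p_def)
      ultimately have "p \<in> I k" by (auto simp: I_def)
      moreover have "x \<in> S k p"
      proof -
        have "real (p j) * r k \<le> x $ j \<and> x $ j \<le> (real (p j) + 1) * r k" if "j \<noteq> i" for j
        proof -
          have "0 \<le> x $ j / r k" using x(2)[of j] r by simp
          then have "real (p j) \<le> x $ j / r k" "x $ j / r k \<le> real (p j) + 1"
            using that by (auto simp: p_def)
          then show ?thesis using r by (auto simp: field_simps)
        qed
        then show ?thesis using k by (auto simp: S_def)
      qed
      ultimately show "x \<in> (\<Union>k. \<Union> (S k ` I k))" by blast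
    qed
    have "(\<Sum>k. ennreal (real (card (S k ` I k)) * (D * r k) powr (real CARD('d) - 1 + s)))
        \<le> (\<Sum>k. ennreal C * ennreal (r k powr s))"
    proof (intro suminf_le allI summableI)
      fix k
      have "card (S k ` I k) \<le> card (I k)" by (intro card_image_le finI)
      then have "real (card (S k ` I k)) \<le> (2 / r k) powr (D - 1)" using cardI[of k] by linarith
      then have "real (card (S k ` I k)) * (D * r k) powr (D - 1 + s) \<le> (2 / r k) powr (D - 1) * (D * r k) powr (D - 1 + s)"
        by (intro mult_right_mono) auto
      also have "\<dots> = C * r k powr s"
        using U(4)[of k] D1 by (simp add: C_def powr_mult powr_divide powr_add powr_diff)
      finally show "ennreal (real (card (S k ` I k)) * (D * r k) powr (real CARD('d) - 1 + s)) \<le> ennreal C * ennreal (r k powr s)"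
        using C by (simp add: D_def ennreal_leI flip: ennreal_mult)
    qed
    also have "\<dots> = ennreal C * (\<Sum>k. ennreal (r k powr s))" by simp
    also have "\<dots> \<le> ennreal C * ennreal (\<epsilon> / C)" using U(6) by (intro mult_left_mono) auto
    also have "\<dots> = ennreal \<epsilon>" using C \<epsilon> by (simp flip: ennreal_mult)
    finally show "(\<Sum>k. ennreal (real (card (S k ` I k)) * (D * r k) powr (real CARD('d) - 1 + s))) \<le> ennreal \<epsilon>" .
  qed
qed

lemma product_dim_le:
  fixes E :: "'d::finite \<Rightarrow> real set"
  assumes E: "\<And>j. E j \<subseteq> {0..1}"
  shows "hausdorff_dim {x :: real ^ 'd. \<forall>j. x $ j \<in> E j} \<le> ereal (real CARD('d) - 1) + hausdorff_dim (E i)"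
proof -
  let ?Q = "{x :: real ^ 'd. \<forall>j. x $ j \<in> E j}" and ?c = "real CARD('d) - 1"
  have c0: "0 \<le> ?c" using zero_less_card_finite[where 'a='d] by linarith
  have "hausdorff_dim ?Q - ereal ?c \<le> hausdorff_dim (E i)"
  proof (rule hausdorff_dim_geI)
    fix s assume s: "0 \<le> s" "hausdorff_measure s (E i) = 0"
    have "hausdorff_dim ?Q \<le> ereal (?c + s)"
    \<comment> \<open>\<open>null_cylinder_set\<close> needs a positive exponent; at exponent 0 the
      factor, hence the product, is empty.\<close>
    proof (cases "s = 0")
      case True
      then have "E i = {}" using s hausdorff_measure_0_empty by auto
      then have Q: "?Q = {}" by auto
      have "hausdorff_measure 0 ({} :: (real ^ 'd) set) = 0"
      proof (rule hausdorff_measure_zeroI)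
        fix \<delta> \<epsilon> :: real assume "0 < \<delta>"
        then have "(\<lambda>_. {}) \<in> delta_covers \<delta> ({} :: (real ^ 'd) set)" by (simp add: delta_covers_def)
        then have "hausdorff_content 0 \<delta> ({} :: (real ^ 'd) set) \<le> (\<Sum>i::nat. diam_gauge 0 ({} :: (real ^ 'd) set))"
          unfolding hausdorff_content_def by (rule INF_lower2) simp
        also have "\<dots> = 0" by (simp add: diam_gauge_def)
        finally show "hausdorff_content 0 \<delta> ({} :: (real ^ 'd) set) \<le> ennreal \<epsilon>" by simp
      qed
      then have "hausdorff_dim ?Q \<le> ereal 0" unfolding Q by (intro hausdorff_dim_le) simp_all
      also have "\<dots> \<le> ereal (?c + s)" using c0 s by simp
      finally show ?thesis .
    next
      case False
      then have "hausdorff_measure (?c + s) ?Q = 0"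
        using s E[THEN subsetD] by (intro null_cylinder_set[of s "E i" _ i]) force+
      then show ?thesis using c0 s by (intro hausdorff_dim_le) auto
    qed
    then show "hausdorff_dim ?Q - ereal ?c \<le> ereal s"
      by (cases "hausdorff_dim ?Q") (auto simp: add.commute)
  qed
  then show ?thesis by (cases "hausdorff_dim ?Q"; cases "hausdorff_dim (E i)") (auto simp: algebra_simps)
qed

subsection \<open>Coding by full words\<close>

definition block_pos :: "(nat \<Rightarrow> nat) \<Rightarrow> nat \<Rightarrow> nat" where
  "block_pos \<l> j = (\<Sum>i<j. \<l> i)"

definition code_sum :: "real \<Rightarrow> (nat \<Rightarrow> nat) \<Rightarrow> (nat \<Rightarrow> real) \<Rightarrow> nat \<Rightarrow> real" where
  "code_sum \<beta> \<l> a j = (\<Sum>i<j. a i / \<beta> ^ block_pos \<l> i)"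

text \<open>The number whose expansion concatenates the words \<open>a 0\<close>,
  \<open>a 1\<close>, and so on. The partial sums increase for non-negative letters, so a supremum
  can stand for the infinite series.\<close>

definition code_point :: "real \<Rightarrow> (nat \<Rightarrow> nat) \<Rightarrow> (nat \<Rightarrow> real) \<Rightarrow> real" where
  "code_point \<beta> \<l> a = (SUP j. code_sum \<beta> \<l> a j)"

lemma block_pos_simps [simp]:
  "block_pos \<l> 0 = 0" "block_pos \<l> (Suc j) = block_pos \<l> j + \<l> j"
  by (simp_all add: block_pos_def)

lemma code_sum_simps [simp]:
  "code_sum \<beta> \<l> a 0 = 0" "code_sum \<beta> \<l> a (Suc j) = code_sum \<beta> \<l> a j + a j / \<beta> ^ block_pos \<l> j"
  by (simp_all add: code_sum_def)

context beta_base
begin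

lemma code_sum_full:
  "(\<And>i. i < j \<Longrightarrow> full \<beta> (\<l> i) (a i)) \<Longrightarrow> full \<beta> (block_pos \<l> j) (code_sum \<beta> \<l> a j)"
proof (induction j)
  case 0 then show ?case using full_zero[of 0] by simp
next
  case (Suc j)
  then have "full \<beta> (block_pos \<l> j) (code_sum \<beta> \<l> a j)" "full \<beta> (\<l> j) (a j)" by auto
  from full_append[OF this] show ?case by simp
qed

text \<open>Decoding from the right: a sum of \<open>Suc j\<close> blocks lies in the cylinder of
  its own prefix of \<open>j\<close> blocks, so equal sums have equal prefixes and then equal last
  letters.\<close>

lemma code_sum_inj:
  assumes "\<And>i. full \<beta> (\<l> i) (a i)" "\<And>i. full \<beta> (\<l> i) (a' i)"
    and "code_sum \<beta> \<l> a j = code_sum \<beta> \<l> a' j" "i < j"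
  shows "a i = a' i"
  using assms(3,4)
proof (induction j)
  case (Suc j)
  let ?p = "block_pos \<l> j" and ?s = "code_sum \<beta> \<l> a j" and ?s' = "code_sum \<beta> \<l> a' j"
  have f: "full \<beta> ?p ?s" "full \<beta> ?p ?s'" using code_sum_full assms by auto
  have "?s + a j / \<beta> ^ ?p \<in> {?s..<?s + 1 / \<beta> ^ ?p}" "?s' + a' j / \<beta> ^ ?p \<in> {?s'..<?s' + 1 / \<beta> ^ ?p}"
    using full_bounds[OF assms(1)[of j]] full_bounds[OF assms(2)[of j]] by (auto simp: divide_strict_right_mono)
  then have eq: "?s = ?s'" using Suc.prems(1) by (intro cyl_unique[OF f, of "?s + a j / \<beta> ^ ?p"]) auto
  then have "a j = a' j" using Suc.prems(1) by simp
  then show ?case using Suc eq by (cases "i = j") auto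
qed simp

text \<open>The strict bound on \<open>a i + 1 / \<beta> ^ \<l> i\<close> makes the right ends of
  the nested cylinders strictly decrease, so the limit avoids the right ends, which the half-open
  intervals exclude.\<close>

lemma code_point_in:
  assumes "\<And>i. full \<beta> (\<l> i) (a i)" "\<And>i. a i + 1 / \<beta> ^ \<l> i < 1"
  shows "code_point \<beta> \<l> a \<in> {code_sum \<beta> \<l> a j..<code_sum \<beta> \<l> a j + 1 / \<beta> ^ block_pos \<l> j}"
proof -
  let ?s = "code_sum \<beta> \<l> a" and ?w = "\<lambda>j. 1 / \<beta> ^ block_pos \<l> j"
  have inc: "incseq ?s" using full_bounds[OF assms(1)] by (intro incseq_SucI) simp
  have dec1: "?s (Suc j) + ?w (Suc j) < ?s j + ?w j" for j
  proof -
    have "(a j + 1 / \<beta> ^ \<l> j) / \<beta> ^ block_pos \<l> j < 1 / \<beta> ^ block_pos \<l> j"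
      using assms(2) by (intro divide_strict_right_mono) auto
    then show ?thesis by (simp add: power_add add_divide_distrib mult.commute)
  qed
  then have dec: "decseq (\<lambda>j. ?s j + ?w j)" by (intro decseq_SucI less_imp_le)
  have le: "?s i \<le> ?s j + ?w j" for i j
  proof (cases "i \<le> j")
    case True
    have "0 \<le> ?w j" by simp
    then show ?thesis using incseqD[OF inc True] by linarith
  next
    case False
    then have "j \<le> i" by simp
    from decseqD[OF dec this] have "?s i + ?w i \<le> ?s j + ?w j" .
    moreover have "0 \<le> ?w i" by simp
    ultimately show ?thesis by linarith
  qed
  have "code_point \<beta> \<l> a \<le> ?s (Suc j) + ?w (Suc j)"
    unfolding code_point_def by (intro cSUP_least le) auto
  moreover have "?s j \<le> code_point \<beta> \<l> a"
    unfolding code_point_def using le[of _ 0] by (intro cSUP_upper) (auto intro!: bdd_aboveI)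
  ultimately show ?thesis using dec1[of j] by auto
qed

lemma code_point_tail:
  assumes "\<And>i. full \<beta> (\<l> i) (a i)" "\<And>i. a i + 1 / \<beta> ^ \<l> i < 1"
  shows "T (block_pos \<l> j) (code_point \<beta> \<l> a) \<in> {a j..<a j + 1 / \<beta> ^ \<l> j}"
proof -
  let ?X = "code_point \<beta> \<l> a" and ?p = "block_pos \<l> j" and ?s = "code_sum \<beta> \<l> a j"
  have "T ?p ?X = \<beta> ^ ?p * (?X - ?s)"
    using cyl_T[OF code_sum_full code_point_in] assms by blast
  moreover have "a j / \<beta> ^ ?p \<le> ?X - ?s" "?X - ?s < (a j + 1 / \<beta> ^ \<l> j) / \<beta> ^ ?p"
    using code_point_in[of \<l> a "Suc j"] assms by (auto simp: power_add add_divide_distrib mult.commute)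
  then have "a j \<le> (?X - ?s) * \<beta> ^ ?p" "(?X - ?s) * \<beta> ^ ?p < a j + 1 / \<beta> ^ \<l> j"
    by (simp_all only: pos_divide_le_eq[OF pos(4)] pos_less_divide_eq[OF pos(4)])
  ultimately show ?thesis by (simp add: mult.commute)
qed

text \<open>All digits of \<open>v\<close> after \<open>q\<close> are zeros, so \<open>v\<close> is
  a left endpoint of order \<open>q\<close> as well. The interval is kept, although the cylinder of
  order \<open>q\<close> may extend further.\<close>

lemma cyl_prefix: "cyl \<beta> m v e \<Longrightarrow> q \<le> m \<Longrightarrow> T q v = 0 \<Longrightarrow> cyl \<beta> q v e"
  unfolding cyl_def by (meson le_trans)

text \<open>Here \<open>i\<close> is the number of zeros with which the expansion of
  \<open>x\<close> begins.\<close>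

lemma scale_to_unit:
  assumes "0 < x" "x < 1"
  obtains i where "\<beta> ^ i * x < 1" "1 \<le> \<beta> ^ Suc i * x" "real i \<le> - log \<beta> x"
proof -
  define k where "k = (LEAST n. 1 \<le> \<beta> ^ n * x)"
  obtain n where "1 / x < \<beta> ^ n" using real_arch_pow[OF gt1] by blast
  then have ex: "1 \<le> \<beta> ^ n * x" using assms by (simp add: field_simps)
  have k: "1 \<le> \<beta> ^ k * x" using LeastI[of "\<lambda>n. 1 \<le> \<beta> ^ n * x" n, OF ex] by (simp add: k_def)
  then obtain i where i: "k = Suc i" using assms by (cases k) auto
  have lt: "\<beta> ^ i * x < 1" using not_less_Least[of i "\<lambda>n. 1 \<le> \<beta> ^ n * x"] i by (auto simp: k_def)
  have "log \<beta> (\<beta> ^ i * x) < 0" using lt assms gt1 by (subst log_less_zero_cancel_iff) auto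
  then have "real i \<le> - log \<beta> x" using assms gt1 by (simp add: log_mult log_nat_power)
  with that lt k i show thesis by blast
qed

text \<open>
  The word consists of the first \<open>q\<close> digits of \<open>v\<close>, about \<open>- log \<beta> x\<close> zeros and a full word of
  length \<open>L\<close>, where \<open>L\<close> depends on \<open>\<eta>\<close> but not on \<open>x\<close>. Cutting \<open>v\<close> at its last non-zero digit
  prevents the orbit from coming too close to \<open>0\<close> before time \<open>q\<close>.
\<close>

lemma special_word:
  assumes v: "full \<beta> m v" "v + 1 / \<beta> ^ m < 1" and q: "q \<le> m" "T q v = 0"
    and \<eta>: "0 < \<eta>" "\<eta> < 1"
  obtains L where "\<And>x. \<lbrakk>0 < x; x < 1; x \<le> \<beta> ^ q / \<beta> ^ m\<rbrakk> \<Longrightarrow> \<exists>l w. full \<beta> (q + l) w \<and> v \<le> w \<and>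
     w + 1 / \<beta> ^ (q + l) < 1 \<and> m \<le> q + l \<and> real l \<le> - log \<beta> x + real L \<and>
     (\<forall>y\<in>{w..<w + 1 / \<beta> ^ (q + l)}. (\<forall>i<q. T i v \<le> T i y) \<and> (1 - \<eta>) * x \<le> T q y \<and> T q y < x \<and>
       (\<forall>i. q \<le> i \<longrightarrow> i \<le> q + l \<longrightarrow> (1 - \<eta>) * x \<le> T i y \<or> T (q + l) y / \<beta> ^ L \<le> T i y))"
proof -
  have "(\<lambda>n. (real n + 2) / \<beta> ^ n) \<longlonglongrightarrow> 0"
  proof -
    have "(\<lambda>n. real n * (1 / \<beta>) ^ n + 2 * (1 / \<beta>) ^ n) \<longlonglongrightarrow> 0 + 2 * 0"
      using gt1 by (intro tendsto_intros powser_times_n_limit_0 LIMSEQ_power_zero) auto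
    then show ?thesis by (simp add: power_divide add_divide_distrib)
  qed
  then have "eventually (\<lambda>n. (real n + 2) / \<beta> ^ n < \<eta> / \<beta>) sequentially"
    using \<eta> by (intro order_tendstoD) auto
  \<comment> \<open>After the leading zeros are removed, the target interval has length
    \<open>\<eta> * (\<beta> ^ k * x)\<close>, which is at least \<open>\<eta> / \<beta>\<close> for
    every \<open>x\<close>. Thus one \<open>L\<close> lets \<open>full_in_interval\<close> find a
    word of length \<open>L\<close> in all cases.\<close>
  then obtain L where L: "(real L + 2) / \<beta> ^ L < \<eta> / \<beta>" by (auto simp: eventually_at_top_linorder)
  show thesis
  proof (rule that[of L])
    fix x assume x: "0 < x" "x < 1" "x \<le> \<beta> ^ q / \<beta> ^ m"
    obtain k where k: "\<beta> ^ k * x < 1" "1 \<le> \<beta> ^ Suc k * x" "real k \<le> - log \<beta> x"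
      using scale_to_unit[OF x(1,2)] by metis
    have "\<eta> * 1 \<le> \<eta> * (\<beta> ^ Suc k * x)" using k \<eta> by (intro mult_left_mono) auto
    then have "\<eta> / \<beta> \<le> \<eta> * (\<beta> ^ k * x)" by (simp add: field_simps)
    then have "(real L + 2) / \<beta> ^ L < \<beta> ^ k * x - (1 - \<eta>) * (\<beta> ^ k * x)" using L by (simp add: algebra_simps)
    moreover have "0 \<le> (1 - \<eta>) * (\<beta> ^ k * x)" using \<eta> x by simp
    ultimately obtain u' where u': "full \<beta> L u'" "(1 - \<eta>) * (\<beta> ^ k * x) \<le> u'" "u' + 1 / \<beta> ^ L \<le> \<beta> ^ k * x"
      using full_in_interval[of "(1 - \<eta>) * (\<beta> ^ k * x)" "\<beta> ^ k * x" L] k by auto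
    define u where "u = u' / \<beta> ^ k"
    define l where "l = k + L"
    have fu: "full \<beta> l u" using full_append[OF full_zero u'(1), of k] by (simp add: u_def l_def)
    have u: "(1 - \<eta>) * x \<le> u" "u + 1 / \<beta> ^ l \<le> x"
    proof -
      show "(1 - \<eta>) * x \<le> u" using u'(2) by (simp add: u_def field_simps)
      have "(u' + 1 / \<beta> ^ L) / \<beta> ^ k \<le> x" using u'(3) by (simp add: field_simps)
      then show "u + 1 / \<beta> ^ l \<le> x" by (simp add: u_def l_def power_add add_divide_distrib mult.commute)
    qed
    have u0: "0 < u" using u(1) \<eta> x by (auto intro: less_le_trans[of _ "(1 - \<eta>) * x"])
    define w where "w = v + u / \<beta> ^ q"
    \<comment> \<open>The upper bound on \<open>x\<close> is what makes the inserted word fit into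
      the cylinder of \<open>v\<close>.\<close>
    have xq: "x / \<beta> ^ q \<le> 1 / \<beta> ^ m" using x(3) by (simp add: field_simps)
    have we: "v + (u + 1 / \<beta> ^ l) / \<beta> ^ q \<le> v + x / \<beta> ^ q" using u(2) by (simp add: divide_right_mono)
    have cq: "cyl \<beta> q v (v + 1 / \<beta> ^ m)" using cyl_prefix[OF v(1) q] .
    have fw: "full \<beta> (q + l) w" unfolding w_def using we xq by (intro cyl_append[OF cq fu]) linarith
    have we': "w + 1 / \<beta> ^ (q + l) \<le> v + x / \<beta> ^ q"
      using we by (simp add: w_def power_add add_divide_distrib mult.commute)
    have vw: "v < w" using u0 by (simp add: w_def)
    have ml: "m \<le> q + l"
    proof (rule ccontr)
      assume "\<not> ?thesis"
      then have "1 / \<beta> ^ m \<le> 1 / \<beta> ^ (q + l)" using gt1 by (intro divide_left_mono power_increasing) auto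
      then show False using we' vw xq by linarith
    qed
    have main: "(\<forall>i<q. T i v \<le> T i y) \<and> (1 - \<eta>) * x \<le> T q y \<and> T q y < x \<and>
       (\<forall>i. q \<le> i \<longrightarrow> i \<le> q + l \<longrightarrow> (1 - \<eta>) * x \<le> T i y \<or> T (q + l) y / \<beta> ^ L \<le> T i y)"
      if y: "y \<in> {w..<w + 1 / \<beta> ^ (q + l)}" for y
    proof -
      have yv: "y \<in> {v..<v + 1 / \<beta> ^ m}" using y vw we' xq by auto
      then have y0: "0 \<le> y" using full_bounds[OF v(1)] by auto
      have 1: "T i v \<le> T i y" if "i < q" for i
        using cyl_Ti[OF cq _ yv, of i] that yv by auto
      have Tq: "T q y = \<beta> ^ q * (y - v)" using cyl_T[OF cq yv] .
      have "u / \<beta> ^ q \<le> y - v" "y - v < x / \<beta> ^ q"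
        using y we' by (auto simp: w_def)
      then have "u \<le> T q y" "T q y < x" unfolding Tq by (auto simp: field_simps)
      then have 2: "(1 - \<eta>) * x \<le> T q y" "T q y < x" using u by auto
      \<comment> \<open>While the zeros are being read the orbit only grows. Afterwards at most
        \<open>L\<close> steps of the block remain, and \<open>T_ge\<close> is applied from the end
        of the block.\<close>
      have 3: "(1 - \<eta>) * x \<le> T i y \<or> T (q + l) y / \<beta> ^ L \<le> T i y" if i: "q \<le> i" "i \<le> q + l" for i
      proof (cases "i - q \<le> k")
        case True
        have pj: "1 \<le> \<beta> ^ (i - q)" using gt1 by (simp add: one_le_power)
        have Tq0: "0 \<le> T q y" using T_nonneg[OF y0] .
        have "\<beta> ^ (i - q) * T q y \<le> \<beta> ^ k * T q y" using True gt1 Tq0 by (intro mult_right_mono power_increasing) auto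
        also have "\<dots> \<le> \<beta> ^ k * x" using 2 by (intro mult_left_mono) auto
        also have "\<dots> < 1" by (rule k)
        finally have "T (i - q) (T q y) = \<beta> ^ (i - q) * T q y" using Tq0 by (intro T_small)
        then have "T i y = \<beta> ^ (i - q) * T q y" using T_add[of q "i - q" y] i by simp
        moreover have "1 * T q y \<le> \<beta> ^ (i - q) * T q y" using pj Tq0 by (intro mult_right_mono)
        ultimately show ?thesis using 2 by linarith
      next
        case False
        then have "q + l - i \<le> L" by (simp add: l_def)
        then have "\<beta> ^ (q + l - i) \<le> \<beta> ^ L" using gt1 by (intro power_increasing) auto
        then have "T (q + l) y / \<beta> ^ L \<le> T (q + l) y / \<beta> ^ (q + l - i)"
          using T_nonneg[OF y0] by (intro divide_left_mono) auto
        also have "\<dots> \<le> T i y" using T_ge[OF y0 i(2)] .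
        finally show ?thesis by blast
      qed
      show ?thesis using 1 2 3 by blast
    qed
    have "w + 1 / \<beta> ^ (q + l) < 1" using we' xq v(2) by linarith
    moreover have "real l \<le> - log \<beta> x + real L" using k(3) by (simp add: l_def)
    ultimately show "\<exists>l w. full \<beta> (q + l) w \<and> v \<le> w \<and>
     w + 1 / \<beta> ^ (q + l) < 1 \<and> m \<le> q + l \<and> real l \<le> - log \<beta> x + real L \<and>
     (\<forall>y\<in>{w..<w + 1 / \<beta> ^ (q + l)}. (\<forall>i<q. T i v \<le> T i y) \<and> (1 - \<eta>) * x \<le> T q y \<and> T q y < x \<and>
       (\<forall>i. q \<le> i \<longrightarrow> i \<le> q + l \<longrightarrow> (1 - \<eta>) * x \<le> T i y \<or> T (q + l) y / \<beta> ^ L \<le> T i y))"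
      using fw vw ml main by (intro exI[of _ l] exI[of _ w]) (simp add: less_imp_le)
  qed
qed

end

section \<open>The uniform measure on codes\<close>

text \<open>With \<open>h\<close> the cylinder length, this bounds per coordinate the number of full
  cylinders met by a set of diameter below \<open>h\<close>. Measured from one fixed point in units
  of \<open>h\<close>, the floors are distinct and lie between -2 and 1.\<close>

lemma spaced_card:
  fixes V :: "real set"
  assumes h: "0 < h" and spaced: "\<And>x y. x \<in> V \<Longrightarrow> y \<in> V \<Longrightarrow> x < y \<Longrightarrow> x + h \<le> y"
    and close: "\<And>x y. x \<in> V \<Longrightarrow> y \<in> V \<Longrightarrow> x < y + 2 * h"
  shows "finite V \<and> card V \<le> 4"
proof (cases "V = {}")
  case False
  then obtain m where m: "m \<in> V" by blast
  define g where "g v = \<lfloor>(v - m) / h\<rfloor>" for v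
  have inj: "inj_on g V"
  proof (rule inj_onI, rule ccontr)
    have *: False if "x \<in> V" "y \<in> V" "g x = g y" "x < y" for x y
    proof -
      have "(x - m + h) / h \<le> (y - m) / h" using spaced[OF that(1,2,4)] h by (intro divide_right_mono) auto
      then have "(x - m) / h + 1 \<le> (y - m) / h" using h by (simp add: add_divide_distrib)
      then show False using that(3) unfolding g_def by linarith
    qed
    fix x y assume "x \<in> V" "y \<in> V" "g x = g y" "x \<noteq> y"
    then show False using *[of x y] *[of y x] by (cases "x < y") auto
  qed
  have sub: "g ` V \<subseteq> {-2..1}"
  proof safe
    fix v assume v: "v \<in> V"
    have "-2 < (v - m) / h" "(v - m) / h < 2" using close[OF v m] close[OF m v] h by (auto simp: field_simps)
    then show "g v \<in> {-2..1}" unfolding g_def by (auto simp: le_floor_iff floor_le_iff)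
  qed
  have "card V \<le> card {-2..1::int}" by (rule card_inj_on_le[OF inj sub]) simp
  moreover have "finite V" using finite_imageD[OF finite_subset[OF sub] inj] by simp
  ultimately show ?thesis by simp
qed simp

text \<open>Letters are drawn uniformly and independently over all coordinates and block indices.
  \<open>J c\<close> selects a cylinder length not below \<open>r\<close> for each base separately,
  so a set of diameter below \<open>r\<close> meets at most 4 prefixes in each coordinate, and at
  most \<open>4 ^ CARD('d)\<close> products of cylinders.\<close>

lemma code_measure_dim:
  fixes \<beta> :: "'d::finite \<Rightarrow> real" and \<l> :: "'d \<Rightarrow> nat \<Rightarrow> nat" and A :: "'d \<Rightarrow> nat \<Rightarrow> real set"
    and E :: "(real ^ 'd) set"
  assumes \<beta>: "\<And>c. 1 < \<beta> c"
    and A: "\<And>c j. finite (A c j)" "\<And>c j. A c j \<noteq> {}"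
    and full: "\<And>c j a. a \<in> A c j \<Longrightarrow> full (\<beta> c) (\<l> c j) a \<and> a + 1 / \<beta> c ^ \<l> c j < 1"
    and E: "\<And>a. (\<And>c j. a c j \<in> A c j) \<Longrightarrow> (\<chi> c. code_point (\<beta> c) (\<l> c) (a c)) \<in> E"
    and mass: "\<And>r. 0 < r \<Longrightarrow> r < 1 \<Longrightarrow> \<exists>J. (\<forall>c. r \<le> 1 / \<beta> c ^ block_pos (\<l> c) (J c)) \<and>
        (\<Prod>c\<in>UNIV. \<Prod>i<J c. 1 / real (card (A c i))) \<le> C * r powr s"
    and C: "0 < C"
  shows "ereal s \<le> hausdorff_dim E"
proof -
  define N where "N x = uniform_count_measure (case_prod A x)" for x
  have fin: "finite (case_prod A x)" "case_prod A x \<noteq> {}" for x using A by (auto split: prod.split)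
  interpret product_prob_space N UNIV
    by (rule product_prob_spaceI) (simp add: N_def prob_space_uniform_count_measure fin)
  define M where "M = PiM UNIV N"
  interpret Q: prob_space M unfolding M_def by (rule prob_space_axioms)
  have spaceM: "space M = {\<omega>. \<forall>c j. \<omega> (c, j) \<in> A c j}"
    by (auto simp: M_def space_PiM N_def space_uniform_count_measure PiE_def)
  define X :: "('d \<times> nat \<Rightarrow> real) \<Rightarrow> real ^ 'd" where "X \<omega> = (\<chi> c. code_point (\<beta> c) (\<l> c) (\<lambda>j. \<omega> (c, j)))" for \<omega>
  have bb: "beta_base (\<beta> c)" for c using \<beta> by unfold_locales
  show ?thesis
  proof (rule mass_distribution[where M = M and X = X and C = "4 ^ CARD('d) * C" and \<delta> = 1])
    show "prob_space M" by (rule Q.prob_space_axioms)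
    show "X ` space M \<subseteq> E" using E by (auto simp: spaceM X_def)
    show "0 < 4 ^ CARD('d) * C" using C by simp
    show "(0::real) < 1" by simp
    fix U :: "(real ^ 'd) set" and r :: real
    assume U: "bounded U" "diameter U < r" and r: "0 < r" "r < 1"
    obtain J where J: "\<And>c. r \<le> 1 / \<beta> c ^ block_pos (\<l> c) (J c)"
      "(\<Prod>c\<in>UNIV. \<Prod>i<J c. 1 / real (card (A c i))) \<le> C * r powr s" using mass[OF r] by blast
    define g where "g \<omega> = (\<lambda>c. code_sum (\<beta> c) (\<l> c) (\<lambda>j. \<omega> (c, j)) (J c))" for \<omega> :: "'d \<times> nat \<Rightarrow> real"
    define B where "B = {\<omega> \<in> space M. X \<omega> \<in> U}"
    have full': "full (\<beta> c) (\<l> c i) (\<omega> (c, i))" "\<omega> (c, i) + 1 / \<beta> c ^ \<l> c i < 1" if "\<omega> \<in> space M" for \<omega> c i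
      using full[of "\<omega> (c, i)" c i] that by (auto simp: spaceM)
    have fs: "full (\<beta> c) (block_pos (\<l> c) (J c)) (g \<omega> c)" if "\<omega> \<in> space M" for \<omega> c
      unfolding g_def by (rule beta_base.code_sum_full[OF bb[of c] full'(1)[OF that]])
    have gX: "X \<omega> $ c \<in> {g \<omega> c..<g \<omega> c + 1 / \<beta> c ^ block_pos (\<l> c) (J c)}" if "\<omega> \<in> space M" for \<omega> c
      using beta_base.code_point_in[OF bb[of c], of "\<l> c" "\<lambda>j. \<omega> (c, j)" "J c"] full'[OF that]
      by (simp add: X_def g_def)
    define V where "V c = (\<lambda>\<omega>. g \<omega> c) ` B" for c
    have V: "finite (V c) \<and> card (V c) \<le> 4" for c
    proof (rule spaced_card)
      let ?h = "1 / \<beta> c ^ block_pos (\<l> c) (J c)"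
      show "0 < ?h" using \<beta>[of c] by simp
      fix x y assume "x \<in> V c" "y \<in> V c"
      then obtain \<omega> \<omega>' where w: "\<omega> \<in> B" "\<omega>' \<in> B" "x = g \<omega> c" "y = g \<omega>' c" by (auto simp: V_def)
      then have sp: "\<omega> \<in> space M" "\<omega>' \<in> space M" by (auto simp: B_def)
      show "x + ?h \<le> y" if "x < y"
        using beta_base.full_spaced[OF bb[of c] fs[OF sp(1)] fs[OF sp(2)]] that w by auto
      have "dist (X \<omega>) (X \<omega>') \<le> diameter U" using w by (intro diameter_bounded_bound U) (auto simp: B_def)
      moreover have "\<bar>(X \<omega> - X \<omega>') $ c\<bar> \<le> norm (X \<omega> - X \<omega>')" by (rule component_le_norm_cart)
      ultimately have "\<bar>X \<omega> $ c - X \<omega>' $ c\<bar> < r" using U by (simp add: dist_norm)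
      then show "x < y + 2 * ?h" using J(1)[of c] gX[OF sp(1), of c] gX[OF sp(2), of c] w by auto
    qed
    have gB: "g ` B \<subseteq> PiE UNIV V" by (auto simp: V_def)
    have finV: "finite (PiE UNIV V)" using V by (intro finite_PiE) auto
    have "card (g ` B) \<le> card (PiE UNIV V)" by (intro card_mono finV gB)
    also have "\<dots> = (\<Prod>c\<in>UNIV. card (V c))" by (simp add: card_PiE)
    also have "\<dots> \<le> (\<Prod>c\<in>(UNIV::'d set). 4)" using V by (intro prod_mono) auto
    finally have cardB: "card (g ` B) \<le> 4 ^ CARD('d)" by simp
    define K where "K = (SIGMA c:UNIV. {..<J c})"
    have finK: "finite K" unfolding K_def by auto
    \<comment> \<open>The codes that agree with \<open>\<omega>0\<close> on the first
      \<open>J c\<close> letters of each coordinate \<open>c\<close>.\<close>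
    define Cy where "Cy \<omega>0 = prod_emb UNIV N K (PiE K (\<lambda>x. {\<omega>0 x}))" for \<omega>0
    have setsN: "{\<omega>0 x} \<in> sets (N x)" if "\<omega>0 \<in> space M" for \<omega>0 x
      using that by (cases x) (auto simp: N_def sets_uniform_count_measure spaceM)
    have Cy: "Cy \<omega>0 \<in> sets M" "measure M (Cy \<omega>0) = (\<Prod>c\<in>UNIV. \<Prod>i<J c. 1 / real (card (A c i)))"
      if "\<omega>0 \<in> space M" for \<omega>0
    proof -
      show "Cy \<omega>0 \<in> sets M" unfolding Cy_def M_def using setsN[OF that] finK by (intro sets_PiM_I) auto
      have "measure M (Cy \<omega>0) = (\<Prod>x\<in>K. measure (N x) {\<omega>0 x})"
        unfolding Cy_def M_def using setsN[OF that] finK by (intro measure_PiM_emb) auto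
      also have "\<dots> = (\<Prod>x\<in>K. 1 / real (card (case_prod A x)))"
        using that fin by (intro prod.cong refl) (auto simp: N_def measure_uniform_count_measure spaceM split: prod.split)
      also have "\<dots> = (\<Prod>c\<in>UNIV. \<Prod>i<J c. 1 / real (card (A c i)))"
        unfolding K_def by (subst prod.Sigma) (auto intro!: prod.cong)
      finally show "measure M (Cy \<omega>0) = \<dots>" .
    qed
    \<comment> \<open>One code for each occurring vector of prefix sums. By
      \<open>code_sum_inj\<close>, the cylinder of this code contains all codes with the same
      vector.\<close>
    define rep where "rep u = (SOME \<omega>. \<omega> \<in> B \<and> g \<omega> = u)" for u
    have rep: "rep u \<in> B \<and> g (rep u) = u" if "u \<in> g ` B" for u
    proof -
      have "\<exists>\<omega>. \<omega> \<in> B \<and> g \<omega> = u" using that by blast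
      from someI_ex[OF this] show ?thesis by (simp add: rep_def)
    qed
    have rep': "rep u \<in> space M" if "u \<in> g ` B" for u using rep[OF that] by (simp add: B_def)
    have finB: "finite (g ` B)" using finite_subset[OF gB finV] .
    define F where "F = (\<Union>u\<in>g ` B. Cy (rep u))"
    have "F \<in> sets M" unfolding F_def using finB Cy(1) rep' by (intro sets.finite_UN) auto
    moreover have "X -` U \<inter> space M \<subseteq> F"
    proof
      fix \<omega> assume w: "\<omega> \<in> X -` U \<inter> space M"
      then have wB: "\<omega> \<in> B" by (simp add: B_def)
      let ?u = "g \<omega>"
      have u: "?u \<in> g ` B" using wB by blast
      have "\<omega> x = rep ?u x" if xK: "x \<in> K" for x
      proof -
        obtain c i where x: "x = (c, i)" "i < J c" using xK by (auto simp: K_def)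
        have "code_sum (\<beta> c) (\<l> c) (\<lambda>j. \<omega> (c, j)) (J c) = code_sum (\<beta> c) (\<l> c) (\<lambda>j. rep ?u (c, j)) (J c)"
        proof -
          have "g \<omega> c = g (rep ?u) c" using rep[OF u] by simp
          then show ?thesis unfolding g_def .
        qed
        from beta_base.code_sum_inj[OF bb[of c] _ _ this x(2)] show ?thesis
          using full'(1) w rep'[OF u] x by auto
      qed
      then have "\<omega> \<in> Cy (rep ?u)" using w by (auto simp: Cy_def prod_emb_def M_def space_PiM)
      then show "\<omega> \<in> F" using u by (auto simp: F_def)
    qed
    moreover have "measure M F \<le> 4 ^ CARD('d) * C * r powr s"
    proof -
      have "measure M F \<le> (\<Sum>u\<in>g ` B. measure M (Cy (rep u)))"
        unfolding F_def using finB Cy(1) rep' by (intro Q.finite_measure_subadditive_finite) auto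
      also have "\<dots> \<le> (\<Sum>u\<in>g ` B. C * r powr s)" using Cy(2) rep' J(2) by (intro sum_mono) auto
      also have "\<dots> = real (card (g ` B)) * (C * r powr s)" by simp
      also have "\<dots> \<le> 4 ^ CARD('d) * (C * r powr s)"
      proof (intro mult_right_mono)
        have "real (card (g ` B)) \<le> real (4 ^ CARD('d))" using cardB by (rule of_nat_mono)
        then show "real (card (g ` B)) \<le> 4 ^ CARD('d)" by simp
      qed (use C in auto)
      finally show ?thesis by simp
    qed
    ultimately show "\<exists>F\<in>sets M. X -` U \<inter> space M \<subseteq> F \<and> measure M F \<le> 4 ^ CARD('d) * C * r powr s" by blast
  qed
qed

subsection \<open>Forced returns\<close>

context beta_base
begin

text \<open>\<open>p\<close> is the time at which the block starts. The inequality with \<kappa>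
  says that the block takes up at most the fraction \<kappa> of the time elapsed at its end. The
  assumption on \<open>T (q + l) y\<close> is what the next block provides, since every letter is at
  least \<open>1 / \<beta> ^ m\<close>.\<close>

definition special_block ::
    "nat \<Rightarrow> nat \<Rightarrow> real \<Rightarrow> real \<Rightarrow> (nat \<Rightarrow> real) \<Rightarrow> real \<Rightarrow> nat \<Rightarrow> nat \<Rightarrow> real \<Rightarrow> bool" where
  "special_block m q v \<kappa> \<psi> \<eta> p l w \<longleftrightarrow>
     full \<beta> (q + l) w \<and> v \<le> w \<and> w + 1 / \<beta> ^ (q + l) < 1 \<and> m \<le> q + l \<and>
     (1 - \<kappa>) * real (p + q + l) \<le> real p \<and>
     (\<forall>y\<in>{w..<w + 1 / \<beta> ^ (q + l)}. 1 / \<beta> ^ m \<le> T (q + l) y \<longrightarrow>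
        T q y < \<psi> (p + q) \<and> (\<forall>i\<le>q + l. (1 - \<eta>) * \<psi> (p + i) \<le> T i y))"

text \<open>Monotonicity gives \<open>\<psi> n \<le> \<psi> (p + q)\<close>, so a block starting
  anywhere in the window ends by \<open>n - log \<beta> (\<psi> n) + L\<close>, a bound free of
  \<open>p\<close>. For large \<open>n\<close> the slack between \<kappa>' and \<kappa> absorbs
  \<open>L\<close>, \<open>q\<close> and \<open>m\<close>; for \<open>\<kappa> = 1\<close> the ratio
  condition is trivial.\<close>

lemma special_block_exists:
  fixes \<psi> :: "nat \<Rightarrow> real"
  assumes v: "full \<beta> m v" "v + 1 / \<beta> ^ m < 1" and q: "q \<le> m" "T q v = 0" "\<And>i. i < q \<Longrightarrow> 0 < T i v"
    and \<eta>: "0 < \<eta>" "\<eta> < 1"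
    and \<psi>: "\<And>n. 0 < n \<Longrightarrow> 0 < \<psi> n" "\<And>i j. 0 < i \<Longrightarrow> i \<le> j \<Longrightarrow> \<psi> j \<le> \<psi> i" "\<psi> \<longlonglongrightarrow> 0"
    and \<kappa>: "0 < \<kappa>" "\<kappa> \<le> 1"
    and good: "\<kappa> = 1 \<or> (\<exists>\<kappa>'<\<kappa>. \<exists>\<^sub>\<infinity>n. (1 - \<kappa>') * (real n - log \<beta> (\<psi> n)) \<le> real n)"
  shows "\<exists>n B. q \<le> n \<and> (\<forall>p. n < p + q + m \<longrightarrow> p + q \<le> n \<longrightarrow>
           (\<exists>l w. special_block m q v \<kappa> \<psi> \<eta> p l w \<and> a \<le> real p * ln \<beta> \<and> real (p + q + l) * ln \<beta> \<le> B))"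
proof -
  obtain L where L: "\<And>x. \<lbrakk>0 < x; x < 1; x \<le> \<beta> ^ q / \<beta> ^ m\<rbrakk> \<Longrightarrow> \<exists>l w. full \<beta> (q + l) w \<and> v \<le> w \<and>
     w + 1 / \<beta> ^ (q + l) < 1 \<and> m \<le> q + l \<and> real l \<le> - log \<beta> x + real L \<and>
     (\<forall>y\<in>{w..<w + 1 / \<beta> ^ (q + l)}. (\<forall>i<q. T i v \<le> T i y) \<and> (1 - \<eta>) * x \<le> T q y \<and> T q y < x \<and>
       (\<forall>i. q \<le> i \<longrightarrow> i \<le> q + l \<longrightarrow> (1 - \<eta>) * x \<le> T i y \<or> T (q + l) y / \<beta> ^ L \<le> T i y))"
    using special_word[OF v q(1,2) \<eta>] by metis
  \<comment> \<open>Once \<psi> is below \<theta>, \<open>special_word\<close> applies, times before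
    \<open>q\<close> are covered by the values \<open>T i v\<close>, and the last \<open>L\<close>
    times of the block by the height at which the next block starts.\<close>
  have "\<exists>\<theta>>0. \<theta> < 1 \<and> \<theta> \<le> \<beta> ^ q / \<beta> ^ m \<and> \<theta> \<le> 1 / \<beta> ^ m / \<beta> ^ L \<and> (\<forall>i<q. \<theta> \<le> T i v)"
  proof -
    let ?S = "insert (1/2) (insert (\<beta> ^ q / \<beta> ^ m) (insert (1 / \<beta> ^ m / \<beta> ^ L) ((\<lambda>i. T i v) ` {..<q})))"
    have "0 < Min ?S" using q(3) by (subst Min_gr_iff) auto
    moreover have "Min ?S \<le> x" if "x \<in> ?S" for x using that by (intro Min_le) auto
    ultimately show ?thesis
      by (intro exI[of _ "Min ?S"]) (auto intro!: le_less_trans[of "Min ?S" "1/2" 1])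
  qed
  then obtain \<theta> where \<theta>: "0 < \<theta>" "\<theta> < 1" "\<theta> \<le> \<beta> ^ q / \<beta> ^ m" "\<theta> \<le> 1 / \<beta> ^ m / \<beta> ^ L"
    "\<And>i. i < q \<Longrightarrow> \<theta> \<le> T i v" by blast
  have "eventually (\<lambda>n. \<psi> n < \<theta>) sequentially" using \<psi>(3) \<theta>(1) by (rule order_tendstoD)
  then obtain N0 where N0: "\<And>n. N0 \<le> n \<Longrightarrow> \<psi> n < \<theta>" by (auto simp: eventually_at_top_linorder)
  have ln\<beta>: "0 < ln \<beta>" using gt1 by simp
  obtain N1 :: nat where N1: "a / ln \<beta> < real N1" using reals_Archimedean2 by blast
  have "\<exists>n. q + m + N0 + N1 + 1 \<le> n \<and> (1 - \<kappa>) * (real n - log \<beta> (\<psi> n) + real L) \<le> real n - real q - real m"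
  proof (cases "\<kappa> = 1")
    case True
    then show ?thesis by (intro exI[of _ "q + m + N0 + N1 + 1"]) simp
  next
    case False
    then obtain \<kappa>' where k: "\<kappa>' < \<kappa>" "\<exists>\<^sub>\<infinity>n. (1 - \<kappa>') * (real n - log \<beta> (\<psi> n)) \<le> real n" using good by blast
    have k1: "\<kappa> < 1" using False \<kappa> by simp
    \<comment> \<open>Passing from \<kappa>' to \<kappa> gains the factor \<rho>, which leaves
      \<open>(1 - \<rho>) * n\<close> for the bounded errors.\<close>
    define \<rho> where "\<rho> = (1 - \<kappa>) / (1 - \<kappa>')"
    have \<rho>: "0 < \<rho>" "\<rho> < 1" "\<rho> * (1 - \<kappa>') = 1 - \<kappa>" using k k1 by (auto simp: \<rho>_def)
    obtain N2 :: nat where N2: "(real L + real q + real m) / (1 - \<rho>) < real N2" using reals_Archimedean2 by blast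
    obtain n where n: "q + m + N0 + N1 + 1 + N2 \<le> n" "(1 - \<kappa>') * (real n - log \<beta> (\<psi> n)) \<le> real n"
      using k(2) unfolding INFM_nat_le by blast
    have "(1 - \<kappa>) * (real n - log \<beta> (\<psi> n)) = \<rho> * ((1 - \<kappa>') * (real n - log \<beta> (\<psi> n)))"
      using \<rho>(3) by (metis mult.assoc)
    also have "\<dots> \<le> \<rho> * real n" using n(2) \<rho> by (intro mult_left_mono) auto
    finally have 1: "(1 - \<kappa>) * (real n - log \<beta> (\<psi> n)) \<le> \<rho> * real n" .
    have "real N2 \<le> real n" using n(1) by simp
    then have "(real L + real q + real m) / (1 - \<rho>) < real n" using N2 by linarith
    then have "real L + real q + real m < real n * (1 - \<rho>)" using \<rho> by (simp add: pos_divide_less_eq)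
    moreover have "(1 - \<kappa>) * real L \<le> 1 * real L" using \<kappa> k1 by (intro mult_right_mono) auto
    ultimately have "(1 - \<kappa>) * (real n - log \<beta> (\<psi> n) + real L) \<le> real n - real q - real m"
      using 1 by (simp add: algebra_simps)
    then show ?thesis using n(1) by (intro exI[of _ n]) simp
  qed
  then obtain n where n: "q + m + N0 + N1 + 1 \<le> n"
    "(1 - \<kappa>) * (real n - log \<beta> (\<psi> n) + real L) \<le> real n - real q - real m" by blast
  show ?thesis
  proof (rule exI[of _ n], rule exI[of _ "(real n - log \<beta> (\<psi> n) + real L) * ln \<beta>"], intro conjI allI impI)
    show "q \<le> n" using n by simp
    fix p assume p: "n < p + q + m" "p + q \<le> n"
    then have pN: "N0 \<le> p" "N1 \<le> p" "0 < p" using n(1) by auto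
    have \<psi>\<theta>: "\<psi> (p + i) < \<theta>" for i using N0 pN by simp
    have x: "0 < \<psi> (p + q)" "\<psi> (p + q) < 1" "\<psi> (p + q) \<le> \<beta> ^ q / \<beta> ^ m"
      using \<psi>(1)[of "p + q"] pN \<psi>\<theta>[of q] \<theta> by auto
    obtain l w where lw: "full \<beta> (q + l) w" "v \<le> w" "w + 1 / \<beta> ^ (q + l) < 1" "m \<le> q + l"
      "real l \<le> - log \<beta> (\<psi> (p + q)) + real L"
      "\<And>y i. y \<in> {w..<w + 1 / \<beta> ^ (q + l)} \<Longrightarrow> i < q \<Longrightarrow> T i v \<le> T i y"
      "\<And>y. y \<in> {w..<w + 1 / \<beta> ^ (q + l)} \<Longrightarrow> (1 - \<eta>) * \<psi> (p + q) \<le> T q y \<and> T q y < \<psi> (p + q)"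
      "\<And>y i. y \<in> {w..<w + 1 / \<beta> ^ (q + l)} \<Longrightarrow> q \<le> i \<Longrightarrow> i \<le> q + l \<Longrightarrow>
         (1 - \<eta>) * \<psi> (p + q) \<le> T i y \<or> T (q + l) y / \<beta> ^ L \<le> T i y"
      using L[OF x] by blast
    have "\<psi> n \<le> \<psi> (p + q)" using p pN by (intro \<psi>) auto
    moreover have "0 < \<psi> n" using n by (intro \<psi>) simp
    ultimately have "log \<beta> (\<psi> n) \<le> log \<beta> (\<psi> (p + q))" using gt1 by (subst log_le_cancel_iff) auto
    then have pl: "real (p + q + l) \<le> real n - log \<beta> (\<psi> n) + real L" using lw(5) p by simp
    have "(1 - \<kappa>) * real (p + q + l) \<le> (1 - \<kappa>) * (real n - log \<beta> (\<psi> n) + real L)"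
      using \<kappa> pl by (intro mult_left_mono) auto
    also have "\<dots> \<le> real p" using n(2) p by simp
    finally have kp: "(1 - \<kappa>) * real (p + q + l) \<le> real p" .
    have eta: "(1 - \<eta>) * \<psi> (p + i) \<le> \<psi> (p + i)" for i
      using \<eta> \<psi>(1)[of "p + i"] pN mult_right_mono[of "1 - \<eta>" 1 "\<psi> (p + i)"] by simp
    have "special_block m q v \<kappa> \<psi> \<eta> p l w"
      unfolding special_block_def
    proof (intro conjI ballI impI allI lw(1-4) kp)
      fix y assume y: "y \<in> {w..<w + 1 / \<beta> ^ (q + l)}" "1 / \<beta> ^ m \<le> T (q + l) y"
      show "T q y < \<psi> (p + q)" using lw(7)[OF y(1)] by blast
      fix i assume i: "i \<le> q + l"
      show "(1 - \<eta>) * \<psi> (p + i) \<le> T i y"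
      proof (cases "i < q")
        case True
        then show ?thesis using eta[of i] \<psi>\<theta>[of i] \<theta>(5)[OF True] lw(6)[OF y(1) True] by linarith
      next
        case False
        have "(1 - \<eta>) * \<psi> (p + i) \<le> (1 - \<eta>) * \<psi> (p + q)"
          using \<psi>(2)[of "p + q" "p + i"] False pN \<eta> by (intro mult_left_mono) auto
        moreover have "1 / \<beta> ^ m / \<beta> ^ L \<le> T (q + l) y / \<beta> ^ L" using y(2) by (intro divide_right_mono) auto
        ultimately show ?thesis using lw(8)[OF y(1), of i] False i eta[of i] \<psi>\<theta>[of i] \<theta>(4) by linarith
      qed
    qed
    moreover have "a \<le> real p * ln \<beta>"
    proof -
      have "a / ln \<beta> < real p" using N1 pN by linarith
      then show ?thesis using ln\<beta> by (simp add: pos_divide_less_eq)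
    qed
    moreover have "real (p + q + l) * ln \<beta> \<le> (real n - log \<beta> (\<psi> n) + real L) * ln \<beta>"
      using pl ln\<beta> by (intro mult_right_mono) auto
    ultimately show "\<exists>l w. special_block m q v \<kappa> \<psi> \<eta> p l w \<and> a \<le> real p * ln \<beta> \<and>
        real (p + q + l) * ln \<beta> \<le> (real n - log \<beta> (\<psi> n) + real L) * ln \<beta>" by blast
  qed
qed

end

text \<open>
  A block at position \<open>p\<close> is special iff \<open>p + q\<close> is one of the last \<open>m\<close> integers up to a target
  time \<open>tgt k\<close>. The windows of special blocks are located on the scale \<open>t = n * ln \<beta>\<close>, which is
  common to all bases: the \<open>k\<close>-th one lies in \<open>{\<tau> k..\<epsilon> * \<tau> (Suc k)}\<close>.
\<close>

locale block_scheme = beta_base +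
  fixes m q :: nat and v \<kappa> \<epsilon> :: real and \<psi> \<eta> \<tau> :: "nat \<Rightarrow> real" and A :: "real set"
    and K :: "nat set" and tgt :: "nat \<Rightarrow> nat" and lam :: "nat \<Rightarrow> nat \<Rightarrow> nat" and wd :: "nat \<Rightarrow> nat \<Rightarrow> real"
  assumes m: "0 < m"
    and A: "finite A" "A \<noteq> {}" "\<And>a. a \<in> A \<Longrightarrow> full \<beta> m a \<and> 1 / \<beta> ^ m \<le> a \<and> a + 1 / \<beta> ^ m < 1"
    and v: "1 / \<beta> ^ m \<le> v"
    and \<psi>: "\<And>n. 0 < n \<Longrightarrow> 0 < \<psi> n" "\<psi> \<longlonglongrightarrow> 0"
    and \<epsilon>: "0 < \<epsilon>" "\<epsilon> \<le> 1" and \<kappa>: "0 < \<kappa>" "\<kappa> \<le> 1"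
    and \<tau>: "0 \<le> \<tau> 0" "\<And>k. \<tau> k + 1 \<le> \<tau> (Suc k)"
    and K: "infinite K" and \<eta>: "\<eta> \<longlonglongrightarrow> 0"
    and slot_q: "\<And>k. k \<in> K \<Longrightarrow> q \<le> tgt k"
    and slot: "\<And>k p. \<lbrakk>k \<in> K; tgt k < p + q + m; p + q \<le> tgt k\<rbrakk> \<Longrightarrow>
       special_block m q v \<kappa> \<psi> (\<eta> k) p (lam k p) (wd k p) \<and> \<tau> k \<le> real p * ln \<beta> \<and>
       real (p + q + lam k p) * ln \<beta> \<le> \<epsilon> * \<tau> (Suc k)"
begin

definition at_slot :: "nat \<Rightarrow> nat \<Rightarrow> bool" where
  "at_slot k p \<longleftrightarrow> k \<in> K \<and> tgt k < p + q + m \<and> p + q \<le> tgt k"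

definition special :: "nat \<Rightarrow> bool" where
  "special p \<longleftrightarrow> (\<exists>k. at_slot k p)"

definition slot_of :: "nat \<Rightarrow> nat" where
  "slot_of p = (SOME k. at_slot k p)"

definition len :: "nat \<Rightarrow> nat" where
  "len p = (if special p then q + lam (slot_of p) p else m)"

text \<open>A one-letter alphabet makes a special block consume time without adding choices. Lengths
  and alphabets depend on the position only, so block boundaries are the same for all codes and the
  code space is a genuine product.\<close>

definition alph :: "nat \<Rightarrow> real set" where
  "alph p = (if special p then {wd (slot_of p) p} else A)"

primrec bp :: "nat \<Rightarrow> nat" where
  "bp 0 = 0"
| "bp (Suc j) = bp j + len (bp j)"

primrec free :: "nat \<Rightarrow> nat" where
  "free 0 = 0"
| "free (Suc j) = free j + (if special (bp j) then 0 else 1)"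

lemma ln_pos: "0 < ln \<beta>"
  using gt1 by simp

lemma block_pos_bp: "block_pos (\<lambda>j. len (bp j)) j = bp j"
  by (induction j) auto

lemma \<tau>_mono: "i \<le> j \<Longrightarrow> \<tau> i \<le> \<tau> j"
proof (rule lift_Suc_mono_le[of \<tau>])
  show "\<tau> n \<le> \<tau> (Suc n)" for n using \<tau>(2)[of n] by linarith
qed

lemma \<tau>_ge: "real k \<le> \<tau> k"
proof (induction k)
  case (Suc k) then show ?case using \<tau>(2)[of k] by simp
qed (use \<tau>(1) in simp)

lemma \<tau>_nonneg: "0 \<le> \<tau> k"
  using \<tau>_ge[of k] by linarith

lemma \<epsilon>\<tau>_le: "\<epsilon> * \<tau> k \<le> \<tau> k"
  using mult_right_mono[OF \<epsilon>(2) \<tau>_nonneg[of k]] by simp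

lemma at_slotD:
  assumes "at_slot k p"
  shows "special_block m q v \<kappa> \<psi> (\<eta> k) p (lam k p) (wd k p)" "\<tau> k \<le> real p * ln \<beta>"
    "real (p + q + lam k p) * ln \<beta> \<le> \<epsilon> * \<tau> (Suc k)" "m \<le> q + lam k p"
  using slot[of k p] assms by (auto simp: at_slot_def special_block_def)

lemma at_slot_of: "special p \<Longrightarrow> at_slot (slot_of p) p"
  unfolding special_def slot_of_def by (rule someI_ex)

lemma special_len:
  assumes "special p"
  shows "\<tau> (slot_of p) \<le> real p * ln \<beta>" "real (p + len p) * ln \<beta> \<le> \<epsilon> * \<tau> (Suc (slot_of p))"
    "(1 - \<kappa>) * real (p + len p) \<le> real p"
  using at_slotD[OF at_slot_of[OF assms]] assms by (auto simp: len_def special_block_def add.assoc)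

lemma len_ge: "m \<le> len p"
  using at_slotD(4)[OF at_slot_of] by (auto simp: len_def)

lemma bp_less: "bp j < bp (Suc j)"
  using len_ge[of "bp j"] m by simp

lemma bp_strict_mono: "strict_mono bp"
  unfolding strict_mono_Suc_iff using bp_less by blast

lemma bp_mono: "i \<le> j \<Longrightarrow> bp i \<le> bp j"
  using bp_strict_mono by (simp add: strict_mono_less_eq)

lemma bp_interval:
  obtains j where "bp j \<le> n" "n < bp (Suc j)"
proof -
  have "\<exists>j. bp j \<le> n \<and> n < bp (Suc j)"
  proof (induction n)
    case 0 show ?case using bp_less[of 0] by (intro exI[of _ 0]) simp
  next
    case (Suc n)
    then obtain j where j: "bp j \<le> n" "n < bp (Suc j)" by blast
    show ?case
    proof (cases "Suc n < bp (Suc j)")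
      case True then show ?thesis using j by (intro exI[of _ j]) simp
    next
      case False
      then have "bp (Suc j) = Suc n" using j by simp
      then show ?thesis using bp_less[of "Suc j"] by (intro exI[of _ "Suc j"]) simp
    qed
  qed
  with that show thesis by blast
qed

lemma slot_order:
  assumes "at_slot k p" "at_slot k' p'" "k < k'"
  shows "p + q + lam k p \<le> p'"
proof -
  have "real (p + q + lam k p) * ln \<beta> \<le> \<epsilon> * \<tau> (Suc k)" using at_slotD(3)[OF assms(1)] .
  also have "\<dots> \<le> \<tau> (Suc k)" by (rule \<epsilon>\<tau>_le)
  also have "\<dots> \<le> \<tau> k'" using assms(3) by (intro \<tau>_mono) simp
  also have "\<dots> \<le> real p' * ln \<beta>" using at_slotD(2)[OF assms(2)] .
  finally show ?thesis using ln_pos by (simp add: mult_le_cancel_right)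
qed

lemma slot_unique:
  assumes "at_slot k p" "at_slot k' p" shows "k = k'"
proof -
  have *: False if "at_slot k p" "at_slot k' p" "k < k'" for k k'
    using slot_order[OF that] at_slotD(4)[OF that(1)] m by linarith
  show ?thesis using *[of k k'] *[of k' k] assms by (cases k k' rule: linorder_cases) auto
qed

text \<open>A free block has length \<open>m\<close>, so if the block containing
  \<open>tgt k - q\<close> were free, it would start inside the window of slot \<open>k\<close>. If
  it is special, \<open>slot_order\<close> excludes every other slot.\<close>

lemma slot_hit:
  assumes k: "k \<in> K"
  obtains j where "special (bp j)" "slot_of (bp j) = k"
proof -
  define p where "p = tgt k - q"
  have p: "at_slot k p" "p + q = tgt k" using k slot_q[OF k] m by (auto simp: at_slot_def p_def)
  obtain j where j: "bp j \<le> p" "p < bp (Suc j)" by (rule bp_interval)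
  have "at_slot k (bp j)"
  proof (cases "special (bp j)")
    case False
    then show ?thesis using j p k by (auto simp: at_slot_def len_def)
  next
    case True
    define k' where "k' = slot_of (bp j)"
    have k': "at_slot k' (bp j)" "len (bp j) = q + lam k' (bp j)" using True at_slot_of by (auto simp: k'_def len_def)
    have "\<not> k' < k" using slot_order[OF k'(1) p(1)] k'(2) j by auto
    moreover have "\<not> k < k'" using slot_order[OF p(1) k'(1)] at_slotD(4)[OF p(1)] m j by auto
    ultimately show ?thesis using k' by simp
  qed
  moreover from this have "special (bp j)" by (auto simp: special_def)
  ultimately show thesis using that slot_unique at_slot_of by blast
qed

lemma alph_letters:
  assumes "a \<in> alph p"
  shows "full \<beta> (len p) a" "a + 1 / \<beta> ^ len p < 1" "1 / \<beta> ^ m \<le> a"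
proof -
  have "full \<beta> (len p) a \<and> a + 1 / \<beta> ^ len p < 1 \<and> 1 / \<beta> ^ m \<le> a"
  proof (cases "special p")
    case True
    then show ?thesis
      using assms at_slotD(1)[OF at_slot_of[OF True]] v by (auto simp: alph_def len_def special_block_def)
  next
    case False
    then show ?thesis using assms A(3) by (simp add: alph_def len_def)
  qed
  then show "full \<beta> (len p) a" "a + 1 / \<beta> ^ len p < 1" "1 / \<beta> ^ m \<le> a" by auto
qed

lemma alph_finite: "finite (alph p)" "alph p \<noteq> {}"
  using A by (auto simp: alph_def)

section \<open>Orbits of coded points\<close>

context
  fixes a :: "nat \<Rightarrow> real" and x :: real
  assumes a: "\<And>j. a j \<in> alph (bp j)" and x: "x = code_point \<beta> (\<lambda>j. len (bp j)) a"
begin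

lemma tail_in: "T (bp j) x \<in> {a j..<a j + 1 / \<beta> ^ len (bp j)}"
  using code_point_tail[of "\<lambda>j. len (bp j)" a j] alph_letters(1,2)[OF a] by (simp add: x block_pos_bp)

lemma tail_ge: "1 / \<beta> ^ m \<le> T (bp j) x"
  using tail_in[of j] alph_letters(3)[OF a, of j] by simp

lemma x_in: "0 \<le> x" "x \<le> 1"
proof -
  have "x \<in> {a 0..<a 0 + 1 / \<beta> ^ len (bp 0)}" using tail_in[of 0] by simp
  moreover have "0 < 1 / \<beta> ^ m" by simp
  ultimately show "0 \<le> x" "x \<le> 1" using alph_letters(2,3)[OF a, of 0] unfolding atLeastLessThan_iff by linarith+
qed

lemma orbit_special:
  assumes "special (bp j)"
  shows "T (bp j + q) x < \<psi> (bp j + q)"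
    and "i < len (bp j) \<Longrightarrow> (1 - \<eta> (slot_of (bp j))) * \<psi> (bp j + i) \<le> T (bp j + i) x"
proof -
  let ?k = "slot_of (bp j)" and ?p = "bp j"
  have l: "len ?p = q + lam ?k ?p" and al: "alph ?p = {wd ?k ?p}" using assms by (auto simp: len_def alph_def)
  have sb: "special_block m q v \<kappa> \<psi> (\<eta> ?k) ?p (lam ?k ?p) (wd ?k ?p)" using at_slotD(1)[OF at_slot_of[OF assms]] .
  have in1: "T ?p x \<in> {wd ?k ?p..<wd ?k ?p + 1 / \<beta> ^ (q + lam ?k ?p)}" using tail_in[of j] a[of j] al l by simp
  have "1 / \<beta> ^ m \<le> T (q + lam ?k ?p) (T ?p x)"
    using tail_ge[of "Suc j"] T_add[of ?p "len ?p" x] l by simp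
  then have *: "T q (T ?p x) < \<psi> (?p + q)" "\<And>i. i \<le> q + lam ?k ?p \<Longrightarrow> (1 - \<eta> ?k) * \<psi> (?p + i) \<le> T i (T ?p x)"
    using sb in1 unfolding special_block_def by blast+
  show "T (bp j + q) x < \<psi> (bp j + q)" using *(1) by (simp only: T_add)
  show "(1 - \<eta> (slot_of (bp j))) * \<psi> (bp j + i) \<le> T (bp j + i) x" if "i < len (bp j)"
    using *(2)[of i] that l by (simp add: T_add[of "bp j" i] del: funpow.simps)
qed

text \<open>The next block starts at height at least \<open>1 / \<beta> ^ m\<close> and is at most
  \<open>m\<close> steps away, which costs a second factor \<open>\<beta> ^ m\<close> in
  \<open>T_ge\<close>.\<close>

lemma orbit_regular:
  assumes "\<not> special (bp j)" "i < len (bp j)"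
  shows "1 / \<beta> ^ (2 * m) \<le> T (bp j + i) x"
proof -
  have l: "len (bp j) = m" using assms by (simp add: len_def)
  have "T (bp (Suc j)) x / \<beta> ^ (bp (Suc j) - (bp j + i)) \<le> T (bp j + i) x"
    using assms by (intro T_ge x_in) simp
  moreover have "1 / \<beta> ^ m / \<beta> ^ m \<le> T (bp (Suc j)) x / \<beta> ^ (bp (Suc j) - (bp j + i))"
    using tail_ge[of "Suc j"] T_nonneg[OF x_in(1)] gt1 l
    by (intro frac_le power_increasing) auto
  ultimately show ?thesis by (simp add: mult_2 power_add)
qed

text \<open>Hits come from the infinitely many slots. For \<open>c < 1\<close>, late free blocks
  stay above the constant \<open>1 / \<beta> ^ (2 * m)\<close>, which \<psi> eventually falls below,
  and late special blocks stay above \<open>(1 - \<eta> k) * \<psi> n\<close> with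
  \<open>1 - \<eta> k\<close> exceeding \<open>c\<close>.\<close>

lemma orbit_in_E: "x \<in> E_set \<beta> \<psi>"
proof -
  have "\<exists>\<^sub>\<infinity>n. T n x < \<psi> n"
    unfolding INFM_nat_le
  proof
    fix N
    obtain M :: nat where M: "real N * ln \<beta> < real M" using reals_Archimedean2 by blast
    obtain k where k: "k \<in> K" "M < k" using K by (auto simp: infinite_nat_iff_unbounded)
    obtain j where j: "special (bp j)" "slot_of (bp j) = k" using slot_hit[OF k(1)] .
    have "real N * ln \<beta> < real k" using M k by linarith
    also have "\<dots> \<le> \<tau> k" by (rule \<tau>_ge)
    also have "\<dots> \<le> real (bp j) * ln \<beta>" using special_len(1)[OF j(1)] j(2) by simp
    finally have "N < bp j" using ln_pos by (simp add: mult_less_cancel_right)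
    then show "\<exists>n\<ge>N. T n x < \<psi> n" using orbit_special(1)[OF j(1)] by (intro exI[of _ "bp j + q"]) simp
  qed
  then have W: "x \<in> W_set \<beta> \<psi>" using x_in by (simp add: W_set_iff)
  have "x \<notin> W_set \<beta> (\<lambda>n. c * \<psi> n)" if c: "0 < c" "c < 1" for c
  proof -
    have "eventually (\<lambda>k. \<eta> k < 1 - c) sequentially" using \<eta> c by (intro order_tendstoD) auto
    then obtain k0 where k0: "\<And>k. k0 \<le> k \<Longrightarrow> \<eta> k < 1 - c" by (auto simp: eventually_at_top_linorder)
    \<comment> \<open>A special block of slot \<open>k\<close> ends by clock time
      \<open>\<tau> (Suc k)\<close>, so a special block still running after \<open>N1\<close> has
      \<open>k \<ge> k0\<close>.\<close>
    obtain N1 :: nat where N1: "\<tau> k0 / ln \<beta> < real N1" using reals_Archimedean2 by blast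
    have "eventually (\<lambda>n. \<psi> n < 1 / \<beta> ^ (2 * m)) sequentially" using \<psi>(2) by (rule order_tendstoD) simp
    then obtain N2 where N2: "\<And>n. N2 \<le> n \<Longrightarrow> \<psi> n < 1 / \<beta> ^ (2 * m)" by (auto simp: eventually_at_top_linorder)
    have ge: "c * \<psi> n \<le> T n x" if n: "N1 + N2 + 1 \<le> n" for n
    proof -
      have p\<psi>: "0 < \<psi> n" using n by (intro \<psi>) simp
      then have c\<psi>: "c * \<psi> n \<le> \<psi> n" using c by simp
      obtain j where j: "bp j \<le> n" "n < bp (Suc j)" by (rule bp_interval)
      define i where "i = n - bp j"
      have i: "n = bp j + i" "i < len (bp j)" using j by (auto simp: i_def)
      show ?thesis
      proof (cases "special (bp j)")
        case False
        then show ?thesis using orbit_regular[OF False i(2)] c\<psi> N2[of n] n i(1) by simp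
      next
        case True
        let ?k = "slot_of (bp j)"
        have "\<tau> k0 < real N1 * ln \<beta>" using N1 ln_pos by (simp add: pos_divide_less_eq)
        also have "\<dots> \<le> real (bp j + len (bp j)) * ln \<beta>" using n j ln_pos by (intro mult_right_mono) auto
        also have "\<dots> \<le> \<tau> (Suc ?k)" using special_len(2)[OF True] \<epsilon>\<tau>_le by (rule order_trans)
        finally have "k0 \<le> ?k" using \<tau>_mono[of "Suc ?k" k0] by (cases "k0 \<le> ?k") auto
        then have "c * \<psi> n \<le> (1 - \<eta> ?k) * \<psi> n" using k0 p\<psi> by (intro mult_right_mono) (auto simp: less_imp_le algebra_simps dest: k0)
        also have "\<dots> \<le> T n x" using orbit_special(2)[OF True i(2)] i(1) by simp
        finally show ?thesis .
      qed
    qed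
    have "\<not> (\<exists>\<^sub>\<infinity>n. T n x < c * \<psi> n)"
    proof
      assume "\<exists>\<^sub>\<infinity>n. T n x < c * \<psi> n"
      then obtain n where "N1 + N2 + 1 \<le> n" "T n x < c * \<psi> n" unfolding INFM_nat_le by blast
      then show False using ge[of n] by simp
    qed
    then show ?thesis by (simp add: W_set_iff)
  qed
  with W show ?thesis by (auto simp: E_set_def)
qed

end

section \<open>Counting the free blocks up to a given time\<close>

text \<open>A window has only \<open>m\<close> positions and every block has length at least
  \<open>m\<close>, so no slot is used twice.\<close>

lemma slot_earlier:
  assumes "special (bp i)" "special (bp j)" "i < j"
  shows "slot_of (bp i) < slot_of (bp j)"
proof -
  let ?p = "bp i" and ?k = "slot_of (bp i)" and ?k' = "slot_of (bp j)"
  have s: "at_slot ?k (bp i)" "at_slot ?k' (bp j)" using at_slot_of assms by auto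
  have le: "bp i + len (bp i) \<le> bp j" using bp_mono[of "Suc i" j] assms(3) by simp
  have "\<not> ?k' < ?k" using slot_order[OF s(2,1)] le len_ge[of "bp i"] m by auto
  moreover have "?k \<noteq> ?k'"
  proof
    assume "?k = ?k'"
    then have "tgt ?k < bp i + q + m" "bp j + q \<le> tgt ?k" using s by (auto simp: at_slot_def)
    then show False using le len_ge[of "bp i"] by linarith
  qed
  ultimately show ?thesis by linarith
qed

text \<open>A free block adds the same amount to both sides. A special block of a slot before
  \<open>k\<close> ends by \<open>\<epsilon> * \<tau> k\<close>, so right after it the left side is
  not positive.\<close>

lemma free_ge_before:
  assumes "\<And>i. i < j \<Longrightarrow> special (bp i) \<Longrightarrow> slot_of (bp i) < k"
  shows "real (bp j) * ln \<beta> - \<epsilon> * \<tau> k \<le> real m * ln \<beta> * real (free j)"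
  using assms
proof (induction j)
  case 0 then show ?case using \<epsilon> \<tau>_nonneg[of k] by simp
next
  case (Suc j)
  show ?case
  proof (cases "special (bp j)")
    case False
    then show ?thesis using Suc by (simp add: len_def algebra_simps)
  next
    case True
    have "slot_of (bp j) < k" using Suc.prems True by simp
    then have "\<epsilon> * \<tau> (Suc (slot_of (bp j))) \<le> \<epsilon> * \<tau> k" using \<epsilon> by (intro mult_left_mono \<tau>_mono) auto
    then have "real (bp (Suc j)) * ln \<beta> \<le> \<epsilon> * \<tau> k" using special_len(2)[OF True] by simp
    moreover have "0 \<le> real m * ln \<beta> * real (free (Suc j))" using ln_pos by simp
    ultimately show ?thesis by linarith
  qed
qed

text \<open>Only the latest special block matters: everything up to its start is covered by
  \<open>free_ge_before\<close>, and its start is at least \<open>1 - \<kappa>\<close> times its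
  end. Later free blocks only improve the balance.\<close>

lemma free_ge_upto:
  assumes "\<And>i. i < j \<Longrightarrow> special (bp i) \<Longrightarrow> slot_of (bp i) \<le> k"
  shows "(1 - \<kappa>) * (real (bp j) * ln \<beta>) - \<epsilon> * \<tau> k \<le> real m * ln \<beta> * real (free j)"
  using assms
proof (induction j)
  case 0 then show ?case using \<epsilon> \<tau>_nonneg[of k] by simp
next
  case (Suc j)
  show ?case
  proof (cases "special (bp j)")
    case False
    have "(1 - \<kappa>) * (real m * ln \<beta>) \<le> 1 * (real m * ln \<beta>)" using \<kappa> ln_pos by (intro mult_right_mono) auto
    then show ?thesis using Suc False by (simp add: len_def algebra_simps)
  next
    case True
    have "slot_of (bp i) < k" if "i < j" "special (bp i)" for i
      using slot_earlier[OF that(2) True that(1)] Suc.prems[of j] True by simp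
    then have "real (bp j) * ln \<beta> - \<epsilon> * \<tau> k \<le> real m * ln \<beta> * real (free j)" by (rule free_ge_before)
    moreover have "(1 - \<kappa>) * real (bp j + len (bp j)) * ln \<beta> \<le> real (bp j) * ln \<beta>"
      using special_len(3)[OF True] ln_pos by (intro mult_right_mono) auto
    ultimately show ?thesis using True by (simp add: mult.assoc)
  qed
qed

text \<open>The term \<open>\<epsilon> * \<tau> k\<close> pays for all earlier slots,
  \<open>real m * ln \<beta>\<close> for rounding \<open>t\<close> down to a block boundary. A loss
  proportional to \<open>t\<close> occurs only if slot \<open>k\<close> belongs to this
  factor.\<close>

lemma free_ge:
  assumes t: "\<tau> k \<le> t" "t < \<tau> (Suc k)" and j: "real (bp j) * ln \<beta> \<le> t" "t < real (bp (Suc j)) * ln \<beta>"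
  shows "(if k \<in> K then (1 - \<kappa>) * t else t) - \<epsilon> * \<tau> k - real m * ln \<beta> \<le> real m * ln \<beta> * real (free j)"
proof -
  have le_k: "slot_of (bp i) \<le> k" if "special (bp i)" "i \<le> j" for i
  proof (rule ccontr)
    assume "\<not> ?thesis"
    then have "\<tau> (Suc k) \<le> \<tau> (slot_of (bp i))" by (intro \<tau>_mono) simp
    also have "\<dots> \<le> real (bp i) * ln \<beta>" using special_len(1)[OF that(1)] .
    also have "\<dots> \<le> real (bp j) * ln \<beta>" using bp_mono[OF that(2)] ln_pos by (intro mult_right_mono) auto
    finally show False using j t by simp
  qed
  have slotK: "slot_of (bp i) \<in> K" if "special (bp i)" for i
    using at_slot_of[OF that] by (simp add: at_slot_def)
  have mpos: "0 \<le> real m * ln \<beta>" using ln_pos by simp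
  have k1: "0 \<le> 1 - \<kappa>" "1 - \<kappa> \<le> 1" using \<kappa> by auto
  have t0: "0 \<le> t" using t(1) \<tau>_nonneg[of k] by linarith
  show ?thesis
  proof (cases "special (bp j)")
    case True
    have "\<not> slot_of (bp j) < k"
    proof
      assume "slot_of (bp j) < k"
      then have "\<tau> (Suc (slot_of (bp j))) \<le> \<tau> k" by (intro \<tau>_mono) simp
      then have "real (bp (Suc j)) * ln \<beta> \<le> \<tau> k"
        using special_len(2)[OF True] \<epsilon>\<tau>_le[of "Suc (slot_of (bp j))"] by simp
      then show False using j t by simp
    qed
    then have kj: "slot_of (bp j) = k" using le_k[OF True] by simp
    then have kK: "k \<in> K" using slotK[OF True] by simp
    have "slot_of (bp i) < k" if "i < j" "special (bp i)" for i using slot_earlier[OF that(2) True that(1)] kj by simp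
    then have 1: "real (bp j) * ln \<beta> - \<epsilon> * \<tau> k \<le> real m * ln \<beta> * real (free j)" by (rule free_ge_before)
    have "(1 - \<kappa>) * t \<le> (1 - \<kappa>) * (real (bp j + len (bp j)) * ln \<beta>)" using j k1 by (intro mult_left_mono) auto
    also have "\<dots> = (1 - \<kappa>) * real (bp j + len (bp j)) * ln \<beta>" by simp
    also have "\<dots> \<le> real (bp j) * ln \<beta>" using special_len(3)[OF True] ln_pos by (intro mult_right_mono) auto
    finally show ?thesis using 1 mpos kK by simp
  next
    case False
    then have tj: "t \<le> real (bp j) * ln \<beta> + real m * ln \<beta>" using j by (simp add: len_def algebra_simps)
    show ?thesis
    proof (cases "k \<in> K")
      case True
      have "(1 - \<kappa>) * t \<le> (1 - \<kappa>) * (real (bp j) * ln \<beta> + real m * ln \<beta>)" using tj k1 by (intro mult_left_mono)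
      moreover have "(1 - \<kappa>) * (real m * ln \<beta>) \<le> 1 * (real m * ln \<beta>)" using k1 mpos by (intro mult_right_mono)
      moreover have "(1 - \<kappa>) * (real (bp j) * ln \<beta>) - \<epsilon> * \<tau> k \<le> real m * ln \<beta> * real (free j)"
        using le_k by (intro free_ge_upto) simp
      ultimately show ?thesis using True by (simp add: distrib_left)
    next
      case kK: False
      have "slot_of (bp i) < k" if "i < j" "special (bp i)" for i
        using le_k[OF that(2)] slotK[OF that(2)] kK that(1) by (cases "slot_of (bp i) = k") auto
      then have "real (bp j) * ln \<beta> - \<epsilon> * \<tau> k \<le> real m * ln \<beta> * real (free j)" by (rule free_ge_before)
      then show ?thesis using tj kK by simp
    qed
  qed
qed

lemma prod_card_alph: "(\<Prod>i<j. 1 / real (card (alph (bp i)))) = (1 / real (card A)) ^ free j"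
  by (induction j) (auto simp: alph_def)

end

subsection \<open>The dimension of products\<close>

context beta_base
begin

text \<open>Without the word 0, every letter is at least \<open>1 / \<beta> ^ m\<close>; without the
  word ending at 1, letters satisfy the strict bound required by
  \<open>code_point_in\<close>.\<close>

definition regular_words :: "nat \<Rightarrow> real set" where
  "regular_words m = {a. full \<beta> m a} - {0, 1 - 1 / \<beta> ^ m}"

lemma regular_wordsD:
  assumes "a \<in> regular_words m"
  shows "full \<beta> m a" "1 / \<beta> ^ m \<le> a" "a + 1 / \<beta> ^ m < 1"
proof -
  have a: "full \<beta> m a" "a \<noteq> 0" "a \<noteq> 1 - 1 / \<beta> ^ m" using assms by (auto simp: regular_words_def)
  note b = full_bounds[OF a(1)]
  show "full \<beta> m a" by (rule a)
  show "1 / \<beta> ^ m \<le> a" using full_spaced[OF full_zero a(1)] a(2) b by simp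
  show "a + 1 / \<beta> ^ m < 1" using a(3) b by linarith
qed

lemma finite_regular_words: "finite (regular_words m)"
  by (simp add: regular_words_def full_finite_card)

lemma regular_words_card:
  assumes "0 < \<epsilon>" "\<epsilon> < 1"
  shows "eventually (\<lambda>m. exp ((1 - \<epsilon>) * (real m * ln \<beta>)) \<le> real (card (regular_words m))) sequentially"
proof -
  define Q where "Q = exp (\<epsilon> * ln \<beta>)"
  have ln\<beta>: "0 < ln \<beta>" using gt1 by simp
  have Q: "1 < Q" using assms ln\<beta> by (simp add: Q_def)
  have "(\<lambda>n. real n * (1 / Q) ^ n + 3 * (1 / Q) ^ n) \<longlonglongrightarrow> 0 + 3 * 0"
    using Q by (intro tendsto_intros powser_times_n_limit_0 LIMSEQ_power_zero) auto
  then have "(\<lambda>n. (real n + 3) / Q ^ n) \<longlonglongrightarrow> 0" by (simp add: power_divide add_divide_distrib)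
  \<comment> \<open>The constant 4 covers the lost 1 in \<open>full_card_ge\<close> and the two
    removed words, as \<open>4 * X - 3 \<ge> X\<close> for \<open>X \<ge> 1\<close>.\<close>
  then have "eventually (\<lambda>n. (real n + 3) / Q ^ n < 1 / 4) sequentially" by (rule order_tendstoD) simp
  then show ?thesis
  proof eventually_elim
    case (elim n)
    define X where "X = exp ((1 - \<epsilon>) * (real n * ln \<beta>))"
    have X: "1 \<le> X" using assms ln\<beta> by (simp add: X_def)
    have Qn: "0 < Q ^ n" using Q by simp
    have "X * Q ^ n = exp ((1 - \<epsilon>) * (real n * ln \<beta>) + real n * (\<epsilon> * ln \<beta>))"
      by (simp add: X_def Q_def exp_add exp_of_nat_mult)
    also have "(1 - \<epsilon>) * (real n * ln \<beta>) + real n * (\<epsilon> * ln \<beta>) = real n * ln \<beta>" by (simp add: algebra_simps)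
    also have "exp (real n * ln \<beta>) = \<beta> ^ n" using gt1 by (simp add: exp_of_nat_mult)
    finally have XQ: "X * Q ^ n = \<beta> ^ n" .
    have "4 * (real n + 3) \<le> Q ^ n" using elim Qn by (simp add: pos_divide_less_eq)
    then have "X * (4 * (real n + 3)) \<le> \<beta> ^ n" unfolding XQ[symmetric] using X by (intro mult_left_mono) auto
    then have "4 * X \<le> \<beta> ^ n / (real n + 3)" by (simp add: pos_le_divide_eq algebra_simps)
    then have 1: "4 * X - 1 \<le> real (card {a. full \<beta> n a})" using full_card_ge[of n] by linarith
    have "card {a. full \<beta> n a} - card {0, 1 - 1 / \<beta> ^ n} \<le> card (regular_words n)"
      unfolding regular_words_def by (rule diff_card_le_card_Diff) simp
    moreover have "card {0, 1 - 1 / \<beta> ^ n} \<le> 2" by (simp add: card_insert_if)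
    ultimately have "card {a. full \<beta> n a} \<le> card (regular_words n) + 2" by linarith
    then have "real (card {a. full \<beta> n a}) \<le> real (card (regular_words n)) + 2" by linarith
    then show ?case using 1 X unfolding X_def by linarith
  qed
qed

lemma first_zero:
  assumes "full \<beta> m v"
  obtains q where "q \<le> m" "T q v = 0" "\<And>i. i < q \<Longrightarrow> 0 < T i v"
proof -
  define q where "q = (LEAST n. T n v = 0)"
  have m: "T m v = 0" using cyl_bounds[OF assms] by blast
  have "T i v \<noteq> 0" if "i < q" for i using not_less_Least[of i "\<lambda>n. T n v = 0"] that by (simp add: q_def)
  moreover have "0 \<le> T i v" for i using T_nonneg full_bounds[OF assms] by simp
  ultimately have "0 < T i v" if "i < q" for i using that by (simp add: less_le)
  moreover have "T q v = 0" unfolding q_def using LeastI[of "\<lambda>n. T n v = 0", OF m] .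
  moreover have "q \<le> m" unfolding q_def using Least_le[of "\<lambda>n. T n v = 0", OF m] .
  ultimately show thesis using that by blast
qed

end

text \<open>Hides the scheme behind an existence statement, so that the systems of the different
  bases can be picked by choice and combined.\<close>

lemma (in block_scheme) block_system:
  assumes card: "exp ((1 - \<epsilon>) * (real m * ln \<beta>)) \<le> real (card A)"
  shows "\<exists>\<l> B. (\<forall>j. finite (B j) \<and> B j \<noteq> {} \<and> (\<forall>a\<in>B j. full \<beta> (\<l> j) a \<and> a + 1 / \<beta> ^ \<l> j < 1)) \<and>
     (\<forall>a. (\<forall>j. a j \<in> B j) \<longrightarrow> code_point \<beta> \<l> a \<in> E_set \<beta> \<psi>) \<and>
     (\<forall>k t. \<tau> k \<le> t \<longrightarrow> t < \<tau> (Suc k) \<longrightarrow> (\<exists>j. real (block_pos \<l> j) * ln \<beta> \<le> t \<and>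
        (\<Prod>i<j. 1 / real (card (B i))) \<le>
           exp (- ((1 - \<epsilon>) * (t - (if k \<in> K then \<kappa> * t else 0) - \<epsilon> * \<tau> k - real m * ln \<beta>)))))"
proof (rule exI[of _ "\<lambda>j. len (bp j)"], rule exI[of _ "\<lambda>j. alph (bp j)"], intro conjI allI impI)
  fix j show "finite (alph (bp j))" "alph (bp j) \<noteq> {}" by (rule alph_finite)+
  show "\<forall>a\<in>alph (bp j). full \<beta> (len (bp j)) a \<and> a + 1 / \<beta> ^ len (bp j) < 1" using alph_letters by blast
next
  fix a assume "\<forall>j. a j \<in> alph (bp j)"
  then show "code_point \<beta> (\<lambda>j. len (bp j)) a \<in> E_set \<beta> \<psi>" using orbit_in_E by blast
next
  fix k t assume t: "\<tau> k \<le> t" "t < \<tau> (Suc k)"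
  have t0: "0 \<le> t" using t(1) \<tau>_nonneg[of k] by linarith
  define n where "n = nat \<lfloor>t / ln \<beta>\<rfloor>"
  have "0 \<le> t / ln \<beta>" using t0 ln_pos by simp
  then have n: "real n \<le> t / ln \<beta>" "t / ln \<beta> < real n + 1" unfolding n_def by linarith+
  obtain j where j: "bp j \<le> n" "n < bp (Suc j)" by (rule bp_interval)
  have "real (bp j) \<le> t / ln \<beta>" using j(1) n(1) by linarith
  then have 1: "real (bp j) * ln \<beta> \<le> t" using ln_pos by (simp add: pos_le_divide_eq)
  have "t / ln \<beta> < real (bp (Suc j))" using j(2) n(2) by linarith
  then have 2: "t < real (bp (Suc j)) * ln \<beta>" using ln_pos by (simp add: pos_divide_less_eq del: bp.simps)
  have "1 / real (card A) \<le> 1 / exp ((1 - \<epsilon>) * (real m * ln \<beta>))" using card by (intro frac_le) auto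
  then have "(1 / real (card A)) ^ free j \<le> exp (- ((1 - \<epsilon>) * (real m * ln \<beta>))) ^ free j"
    by (intro power_mono) (auto simp: exp_minus inverse_eq_divide)
  also have "\<dots> = exp (- ((1 - \<epsilon>) * (real m * ln \<beta> * real (free j))))"
    by (simp add: algebra_simps flip: exp_of_nat_mult)
  also have "\<dots> \<le> exp (- ((1 - \<epsilon>) * (t - (if k \<in> K then \<kappa> * t else 0) - \<epsilon> * \<tau> k - real m * ln \<beta>)))"
  proof -
    have "(1 - \<epsilon>) * (t - (if k \<in> K then \<kappa> * t else 0) - \<epsilon> * \<tau> k - real m * ln \<beta>) \<le> (1 - \<epsilon>) * (real m * ln \<beta> * real (free j))"
      using free_ge[OF t 1 2] \<epsilon> by (intro mult_left_mono) (auto simp: left_diff_distrib split: if_splits)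
    then show ?thesis by simp
  qed
  finally have "(\<Prod>i<j. 1 / real (card (alph (bp i)))) \<le>
     exp (- ((1 - \<epsilon>) * (t - (if k \<in> K then \<kappa> * t else 0) - \<epsilon> * \<tau> k - real m * ln \<beta>)))"
    by (simp add: prod_card_alph)
  then show "\<exists>j. real (block_pos (\<lambda>j. len (bp j)) j) * ln \<beta> \<le> t \<and> (\<Prod>i<j. 1 / real (card (alph (bp i)))) \<le>
     exp (- ((1 - \<epsilon>) * (t - (if k \<in> K then \<kappa> * t else 0) - \<epsilon> * \<tau> k - real m * ln \<beta>)))"
    using 1 by (auto simp: block_pos_bp)
qed

section \<open>Choice of parameters and scheduling of the factors\<close>

text \<open>\<open>\<kappa>0\<close> is \<alpha> / (1 + \<alpha>). Any \<kappa> slightly above it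
  works: with \<kappa>' in between, \<open>1 / (1 - \<kappa>') - 1\<close> exceeds the liminf and
  therefore the quotients infinitely often. An infinite order leaves
  \<open>\<kappa> = 1\<close>.\<close>

lemma good_slope_exists:
  fixes \<psi> :: "nat \<Rightarrow> real"
  assumes \<beta>: "1 < \<beta>" and \<psi>: "\<And>n. 0 < n \<Longrightarrow> 0 < \<psi> n" "\<psi> \<longlonglongrightarrow> 0"
    and s: "ereal s < ereal (D - 1) + 1 / (1 + lower_order \<beta> \<psi>)"
  shows "\<exists>\<kappa>>0. \<kappa> \<le> 1 \<and> s < D - \<kappa> \<and> (\<kappa> = 1 \<or> (\<exists>\<kappa>'<\<kappa>. \<exists>\<^sub>\<infinity>n. (1 - \<kappa>') * (real n - log \<beta> (\<psi> n)) \<le> real n))"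
proof (cases "lower_order \<beta> \<psi>")
  case (real r)
  have r0: "0 \<le> r" using lower_order_nonneg[OF \<beta> \<psi>] real by simp
  define \<kappa>0 where "\<kappa>0 = 1 - 1 / (1 + r)"
  have k0: "0 \<le> \<kappa>0" "\<kappa>0 < 1" "1 + r = 1 / (1 - \<kappa>0)" using r0 by (auto simp: \<kappa>0_def)
  have "s < D - 1 + 1 / (1 + r)" using s real r0 by (simp add: one_ereal_def)
  then have "\<kappa>0 < D - s" unfolding \<kappa>0_def by linarith
  then have "\<kappa>0 < min 1 (D - s)" using k0(2) by simp
  then obtain \<kappa> where \<kappa>: "\<kappa>0 < \<kappa>" "\<kappa> < min 1 (D - s)" using dense by blast
  then obtain \<kappa>' where \<kappa>': "\<kappa>0 < \<kappa>'" "\<kappa>' < \<kappa>" using dense by blast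
  define y where "y = 1 / (1 - \<kappa>') - 1"
  have "1 / (1 - \<kappa>0) < 1 / (1 - \<kappa>')" using \<kappa> \<kappa>' by (intro divide_strict_left_mono) auto
  then have "r < y" using k0(3) by (simp add: y_def)
  have "\<not> eventually (\<lambda>n. ereal y \<le> ereal (- log \<beta> (\<psi> n) / real n)) sequentially"
  proof
    assume "eventually (\<lambda>n. ereal y \<le> ereal (- log \<beta> (\<psi> n) / real n)) sequentially"
    then have "ereal y \<le> lower_order \<beta> \<psi>" unfolding lower_order_def by (rule Liminf_bounded)
    then show False using \<open>r < y\<close> real by simp
  qed
  then have fr: "\<exists>n\<ge>N. - log \<beta> (\<psi> n) / real n < y" for N by (force simp: eventually_at_top_linorder not_le)
  have "\<exists>\<^sub>\<infinity>n. (1 - \<kappa>') * (real n - log \<beta> (\<psi> n)) \<le> real n"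
    unfolding INFM_nat_le
  proof
    fix N
    obtain n where n: "Suc N \<le> n" "- log \<beta> (\<psi> n) / real n < y" using fr by blast
    then have n0: "0 < real n" by simp
    have "- log \<beta> (\<psi> n) < y * real n" using n(2) by (simp only: pos_divide_less_eq[OF n0])
    then have "real n - log \<beta> (\<psi> n) \<le> (1 + y) * real n" by (simp add: algebra_simps)
    then have "(1 - \<kappa>') * (real n - log \<beta> (\<psi> n)) \<le> (1 - \<kappa>') * ((1 + y) * real n)"
      using \<kappa> \<kappa>' by (intro mult_left_mono) auto
    also have "\<dots> = real n" using \<kappa> \<kappa>' by (simp add: y_def)
    finally show "\<exists>n\<ge>N. (1 - \<kappa>') * (real n - log \<beta> (\<psi> n)) \<le> real n" using n(1) by (intro exI[of _ n]) simp
  qed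
  then show ?thesis using \<kappa> \<kappa>' k0 by (intro exI[of _ \<kappa>]) auto
next
  case PInf
  then have "s < D - 1" using s by simp
  then show ?thesis by (intro exI[of _ 1]) simp
next
  case MInf
  then show ?thesis using lower_order_nonneg[OF \<beta> \<psi>] by simp
qed

lemma product_dim_ge_real:
  fixes \<beta> :: "'d::finite \<Rightarrow> real" and \<psi> :: "'d \<Rightarrow> nat \<Rightarrow> real"
  assumes \<beta>: "\<And>c. 1 < \<beta> c"
    and \<psi>: "\<And>c n. 0 < n \<Longrightarrow> 0 < \<psi> c n" "\<And>c i j. 0 < i \<Longrightarrow> i \<le> j \<Longrightarrow> \<psi> c j \<le> \<psi> c i" "\<And>c. \<psi> c \<longlonglongrightarrow> 0"
    and s: "\<And>c. ereal s < ereal (real CARD('d) - 1) + 1 / (1 + lower_order (\<beta> c) (\<psi> c))"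
  shows "ereal s \<le> hausdorff_dim {x :: real ^ 'd. \<forall>c. x $ c \<in> E_set (\<beta> c) (\<psi> c)}"
proof -
  define D where "D = real CARD('d)"
  have D1: "1 \<le> D" using zero_less_card_finite[where 'a='d] unfolding D_def by linarith
  have bb: "beta_base (\<beta> c)" for c using \<beta> by unfold_locales
  have ln\<beta>: "0 < ln (\<beta> c)" for c using \<beta>[of c] by simp
  define good where "good \<kappa> c \<longleftrightarrow> \<kappa> = 1 \<or> (\<exists>\<kappa>'<\<kappa>. \<exists>\<^sub>\<infinity>n. (1 - \<kappa>') * (real n - log (\<beta> c) (\<psi> c n)) \<le> real n)" for \<kappa> c
  have "\<forall>c. \<exists>\<kappa>>0. \<kappa> \<le> 1 \<and> s < D - \<kappa> \<and> good \<kappa> c"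
    unfolding good_def D_def using good_slope_exists[OF \<beta> \<psi>(1,3) s] by blast
  then obtain kf where kf: "\<And>c. 0 < kf c \<and> kf c \<le> 1 \<and> s < D - kf c \<and> good (kf c) c" by metis
  \<comment> \<open>Goodness persists when \<kappa> grows within the range up to 1, so the worst
    factor supplies a common value.\<close>
  define \<kappa> where "\<kappa> = Max (range kf)"
  have kle: "kf c \<le> \<kappa>" for c unfolding \<kappa>_def by (rule Max_ge) auto
  have "\<kappa> \<in> range kf" unfolding \<kappa>_def by (rule Max_in) auto
  then have \<kappa>: "0 < \<kappa>" "\<kappa> \<le> 1" "s < D - \<kappa>" using kf by auto
  have good: "good \<kappa> c" for c
  proof (cases "kf c = 1")
    case True then show ?thesis using kle[of c] \<kappa>(2) by (simp add: good_def)
  next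
    case False then show ?thesis using kf[of c] less_le_trans[OF _ kle[of c]] unfolding good_def by blast
  qed
  \<comment> \<open>Expanding \<open>(1 - \<epsilon>) * (D - \<kappa> - D * \<epsilon>)\<close>
    gives \<open>D - \<kappa> - 2 * D * \<epsilon>\<close> plus non-negative terms, whence the
    denominator \<open>2 * D\<close>.\<close>
  define \<epsilon> where "\<epsilon> = min (1/2) ((D - \<kappa> - s) / (2 * D))"
  have \<epsilon>: "0 < \<epsilon>" "\<epsilon> < 1" "\<epsilon> \<le> 1" using \<kappa>(3) D1 by (auto simp: \<epsilon>_def)
  have s_le: "s \<le> (1 - \<epsilon>) * (D - \<kappa> - D * \<epsilon>)"
  proof -
    have "\<epsilon> \<le> (D - \<kappa> - s) / (2 * D)" by (simp add: \<epsilon>_def)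
    then have "2 * D * \<epsilon> \<le> D - \<kappa> - s" using D1 by (simp add: pos_le_divide_eq mult.commute)
    moreover have "0 \<le> \<epsilon> * \<kappa>" "0 \<le> \<epsilon> * (D * \<epsilon>)" using \<epsilon> \<kappa> D1 by auto
    ultimately show ?thesis by (simp add: algebra_simps)
  qed
  have "\<forall>c. eventually (\<lambda>m. exp ((1 - \<epsilon>) * (real m * ln (\<beta> c))) \<le> real (card (beta_base.regular_words (\<beta> c) m))) sequentially"
    using beta_base.regular_words_card[OF bb \<epsilon>(1,2)] by blast
  then have "eventually (\<lambda>m. \<forall>c. exp ((1 - \<epsilon>) * (real m * ln (\<beta> c))) \<le> real (card (beta_base.regular_words (\<beta> c) m))) sequentially"
    by (rule eventually_all_finite[OF allE])
  then have "eventually (\<lambda>m. 0 < m \<and> (\<forall>c. exp ((1 - \<epsilon>) * (real m * ln (\<beta> c))) \<le> real (card (beta_base.regular_words (\<beta> c) m)))) sequentially"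
    using eventually_gt_at_top[of 0] by eventually_elim auto
  then obtain m where m: "0 < m" "\<And>c. exp ((1 - \<epsilon>) * (real m * ln (\<beta> c))) \<le> real (card (beta_base.regular_words (\<beta> c) m))"
    by (auto simp: eventually_at_top_linorder)
  define A where "A c = beta_base.regular_words (\<beta> c) m" for c
  have finA: "finite (A c)" for c unfolding A_def by (rule beta_base.finite_regular_words[OF bb])
  have neA: "A c \<noteq> {}" for c
  proof
    assume "A c = {}"
    then show False using m(2)[of c] exp_gt_zero[of "(1 - \<epsilon>) * (real m * ln (\<beta> c))"] by (simp add: A_def)
  qed
  have Aw: "full (\<beta> c) m a \<and> 1 / \<beta> c ^ m \<le> a \<and> a + 1 / \<beta> c ^ m < 1" if "a \<in> A c" for a c
    using beta_base.regular_wordsD[OF bb] that by (simp add: A_def)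
  have "\<forall>c. \<exists>a. a \<in> A c" using neA by auto
  from choice[OF this] obtain v where v: "\<And>c. v c \<in> A c" by auto
  have "\<forall>c. \<exists>q. q \<le> m \<and> (beta_map (\<beta> c) ^^ q) (v c) = 0 \<and> (\<forall>i<q. 0 < (beta_map (\<beta> c) ^^ i) (v c))"
    using beta_base.first_zero[OF bb] Aw[OF v] by metis
  then obtain q where q: "\<And>c. q c \<le> m" "\<And>c. (beta_map (\<beta> c) ^^ q c) (v c) = 0"
    "\<And>c i. i < q c \<Longrightarrow> 0 < (beta_map (\<beta> c) ^^ i) (v c)" by metis
  obtain h where h: "bij_betw h {..<CARD('d)} (UNIV :: 'd set)"
    using ex_bij_betw_nat_finite[of "UNIV :: 'd set"] by (auto simp: lessThan_atLeast0)
  \<comment> \<open>Round robin: each factor gets infinitely many slots, and each slot has exactly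
    one factor.\<close>
  define sched where "sched k = h (k mod CARD('d))" for k
  have inf: "infinite {k. sched k = c}" for c
  proof -
    obtain i where i: "i < CARD('d)" "h i = c" using bij_betw_imp_surj_on[OF h] by (metis UNIV_I imageE lessThan_iff)
    have "\<exists>k>N. sched k = c" for N
    proof (intro exI conjI)
      have "1 * Suc N \<le> CARD('d) * Suc N" by (rule mult_right_mono) (simp_all add: Suc_leI)
      then have "Suc N \<le> i + CARD('d) * Suc N" by (metis mult_1 trans_le_add2)
      then show "N < i + CARD('d) * Suc N" by (rule Suc_le_lessD)
      show "sched (i + CARD('d) * Suc N) = c" using i by (simp add: sched_def del: mult_Suc_right)
    qed
    then show ?thesis by (auto simp: infinite_nat_iff_unbounded)
  qed
  define \<eta> where "\<eta> k = 1 / (real k + 2)" for k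
  have \<eta>: "0 < \<eta> k" "\<eta> k < 1" for k by (auto simp: \<eta>_def)
  have \<eta>0: "\<eta> \<longlonglongrightarrow> 0"
  proof -
    have "(\<lambda>k. inverse (real (Suc (Suc k)))) \<longlonglongrightarrow> 0" by (intro LIMSEQ_Suc LIMSEQ_inverse_real_of_nat)
    then show ?thesis by (simp add: \<eta>_def[abs_def] inverse_eq_divide add.commute)
  qed
  define SB where "SB k p l w = beta_base.special_block (\<beta> (sched k)) m (q (sched k)) (v (sched k)) \<kappa> (\<psi> (sched k)) (\<eta> k) p l w" for k p l w
  define valid where "valid k n p \<longleftrightarrow> n < p + q (sched k) + m \<and> p + q (sched k) \<le> n" for k n p
  have "\<exists>n B. q (sched k) \<le> n \<and> (\<forall>p. valid k n p \<longrightarrow> (\<exists>l w. SB k p l w \<and> a \<le> real p * ln (\<beta> (sched k)) \<and>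
      real (p + q (sched k) + l) * ln (\<beta> (sched k)) \<le> B))" for k a
  proof -
    let ?c = "sched k"
    have fv: "full (\<beta> ?c) m (v ?c)" "v ?c + 1 / \<beta> ?c ^ m < 1" using Aw[OF v] by auto
    show ?thesis unfolding SB_def valid_def imp_conjL
      using beta_base.special_block_exists[OF bb fv q(1,2,3) \<eta> \<psi> \<kappa>(1,2) good[of ?c, unfolded good_def], of k a] by blast
  qed
  then obtain Nf Bf where NB: "\<And>k a. q (sched k) \<le> Nf k a \<and> (\<forall>p. valid k (Nf k a) p \<longrightarrow>
      (\<exists>l w. SB k p l w \<and> a \<le> real p * ln (\<beta> (sched k)) \<and> real (p + q (sched k) + l) * ln (\<beta> (sched k)) \<le> Bf k a))"
    by metis
  \<comment> \<open>\<open>Bf k t\<close> bounds the end of the special block of a slot opened at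
    clock time \<open>t\<close>. Dividing by \<epsilon> delays the next slot until that end is only
    a fraction \<epsilon> of the new start.\<close>
  define \<tau> where "\<tau> = rec_nat 0 (\<lambda>k t. max (t + 1) (Bf k t / \<epsilon>))"
  have \<tau>: "\<tau> 0 = 0" "\<tau> (Suc k) = max (\<tau> k + 1) (Bf k (\<tau> k) / \<epsilon>)" for k by (simp_all add: \<tau>_def)
  have B\<tau>: "Bf k (\<tau> k) \<le> \<epsilon> * \<tau> (Suc k)" for k
  proof -
    have "Bf k (\<tau> k) / \<epsilon> \<le> \<tau> (Suc k)" using \<tau>(2) by simp
    then show ?thesis using \<epsilon> by (simp add: pos_divide_le_eq mult.commute)
  qed
  define tgt where "tgt k = Nf k (\<tau> k)" for k
  have "\<forall>k p. \<exists>l w. valid k (tgt k) p \<longrightarrow> SB k p l w \<and> \<tau> k \<le> real p * ln (\<beta> (sched k)) \<and>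
      real (p + q (sched k) + l) * ln (\<beta> (sched k)) \<le> \<epsilon> * \<tau> (Suc k)"
    using NB B\<tau> order_trans unfolding tgt_def by blast
  then obtain lam wd where lw: "\<And>k p. valid k (tgt k) p \<Longrightarrow> SB k p (lam k p) (wd k p) \<and> \<tau> k \<le> real p * ln (\<beta> (sched k)) \<and>
      real (p + q (sched k) + lam k p) * ln (\<beta> (sched k)) \<le> \<epsilon> * \<tau> (Suc k)" by metis
  have bs: "block_scheme (\<beta> c) m (q c) (v c) \<kappa> \<epsilon> (\<psi> c) \<eta> \<tau> (A c) {k. sched k = c} tgt lam wd" for c
  proof (intro block_scheme.intro bb block_scheme_axioms.intro m finA neA \<psi>(1) \<psi>(3) \<epsilon>(1,3) \<kappa>(1,2) inf \<eta>0)
    show "full (\<beta> c) m a \<and> 1 / \<beta> c ^ m \<le> a \<and> a + 1 / \<beta> c ^ m < 1" if "a \<in> A c" for a using Aw[OF that] .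
    show "1 / \<beta> c ^ m \<le> v c" using Aw[OF v] by blast
    show "0 \<le> \<tau> 0" "\<tau> k + 1 \<le> \<tau> (Suc k)" for k by (simp_all add: \<tau>)
    show "q c \<le> tgt k" if "k \<in> {k. sched k = c}" for k using that NB by (auto simp: tgt_def)
    show "beta_base.special_block (\<beta> c) m (q c) (v c) \<kappa> (\<psi> c) (\<eta> k) p (lam k p) (wd k p) \<and>
        \<tau> k \<le> real p * ln (\<beta> c) \<and> real (p + q c + lam k p) * ln (\<beta> c) \<le> \<epsilon> * \<tau> (Suc k)"
      if "k \<in> {k. sched k = c}" "tgt k < p + q c + m" "p + q c \<le> tgt k" for k p
      using lw[of k p] that by (auto simp: SB_def valid_def)
  qed
  define sys where "sys c \<l> B \<longleftrightarrow>
     (\<forall>j. finite (B j) \<and> B j \<noteq> {} \<and> (\<forall>a\<in>B j. full (\<beta> c) (\<l> j) a \<and> a + 1 / \<beta> c ^ \<l> j < 1)) \<and>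
     (\<forall>a. (\<forall>j. a j \<in> B j) \<longrightarrow> code_point (\<beta> c) \<l> a \<in> E_set (\<beta> c) (\<psi> c)) \<and>
     (\<forall>k t. \<tau> k \<le> t \<longrightarrow> t < \<tau> (Suc k) \<longrightarrow> (\<exists>j. real (block_pos \<l> j) * ln (\<beta> c) \<le> t \<and>
        (\<Prod>i<j. 1 / real (card (B i))) \<le>
           exp (- ((1 - \<epsilon>) * (t - (if sched k = c then \<kappa> * t else 0) - \<epsilon> * \<tau> k - real m * ln (\<beta> c))))))" for c \<l> B
  have "\<forall>c. \<exists>\<l> B. sys c \<l> B"
    using block_scheme.block_system[OF bs] m(2) by (simp add: A_def sys_def)
  then obtain \<l> B where sys: "\<And>c. sys c (\<l> c) (B c)" by metis
  have LB1: "finite (B c j)" "B c j \<noteq> {}" for c j using sys[of c] by (simp_all add: sys_def)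
  have LB2: "full (\<beta> c) (\<l> c j) a \<and> a + 1 / \<beta> c ^ \<l> c j < 1" if "a \<in> B c j" for a c j
    using sys[of c] that by (simp add: sys_def)
  have LB3: "code_point (\<beta> c) (\<l> c) a \<in> E_set (\<beta> c) (\<psi> c)" if "\<And>j. a j \<in> B c j" for c a
    using sys[of c] that by (simp add: sys_def)
  have LB4: "\<exists>j. real (block_pos (\<l> c) j) * ln (\<beta> c) \<le> t \<and> (\<Prod>i<j. 1 / real (card (B c i))) \<le>
      exp (- ((1 - \<epsilon>) * (t - (if sched k = c then \<kappa> * t else 0) - \<epsilon> * \<tau> k - real m * ln (\<beta> c))))"
    if "\<tau> k \<le> t" "t < \<tau> (Suc k)" for c k t
    using sys[of c] that unfolding sys_def by blast
  define C0 where "C0 = (\<Sum>c\<in>UNIV. real m * ln (\<beta> c))"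
  show ?thesis
  proof (rule code_measure_dim[where \<beta> = \<beta> and \<l> = \<l> and A = B and C = "exp ((1 - \<epsilon>) * C0)", OF \<beta>])
    show "finite (B c j)" "B c j \<noteq> {}" for c j by (rule LB1)+
    show "full (\<beta> c) (\<l> c j) a \<and> a + 1 / \<beta> c ^ \<l> c j < 1" if "a \<in> B c j" for a c j by (rule LB2[OF that])
    show "(\<chi> c. code_point (\<beta> c) (\<l> c) (a c)) \<in> {x. \<forall>c. x $ c \<in> E_set (\<beta> c) (\<psi> c)}" if "\<And>c j. a c j \<in> B c j" for a
      using LB3[OF that] by simp
    show "0 < exp ((1 - \<epsilon>) * C0)" by simp
    fix r :: real assume r: "0 < r" "r < 1"
    define t where "t = - ln r"
    have t: "0 < t" "r = exp (- t)" using r by (auto simp: t_def)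
    obtain k where k: "\<tau> k \<le> t" "t < \<tau> (Suc k)"
    proof -
      have ge: "real k \<le> \<tau> k" for k
      proof (induction k)
        case (Suc k) then show ?case using \<tau>(2)[of k] by simp
      qed (simp add: \<tau>)
      obtain N :: nat where "t < real N" using reals_Archimedean2 by blast
      then have ex: "t < \<tau> N" using ge[of N] by linarith
      define k where "k = (LEAST k. t < \<tau> k)"
      have 1: "t < \<tau> k" unfolding k_def using LeastI[of "\<lambda>k. t < \<tau> k", OF ex] .
      then obtain k' where k': "k = Suc k'" using \<tau>(1) t by (cases k) auto
      have "\<tau> k' \<le> t" using not_less_Least[of k' "\<lambda>k. t < \<tau> k"] k' by (simp add: k_def not_less)
      then show thesis using that 1 k' by blast
    qed
    define g where "g c = t - (if sched k = c then \<kappa> * t else 0) - \<epsilon> * \<tau> k - real m * ln (\<beta> c)" for c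
    have "\<forall>c. \<exists>j. real (block_pos (\<l> c) j) * ln (\<beta> c) \<le> t \<and> (\<Prod>i<j. 1 / real (card (B c i))) \<le> exp (- ((1 - \<epsilon>) * g c))"
      using LB4[OF k] by (simp add: g_def)
    then obtain J where J: "\<And>c. real (block_pos (\<l> c) (J c)) * ln (\<beta> c) \<le> t"
      "\<And>c. (\<Prod>i<J c. 1 / real (card (B c i))) \<le> exp (- ((1 - \<epsilon>) * g c))" by metis
    have "r \<le> 1 / \<beta> c ^ block_pos (\<l> c) (J c)" for c
    proof -
      have "r \<le> exp (- (real (block_pos (\<l> c) (J c)) * ln (\<beta> c)))" using J(1)[of c] t by simp
      also have "\<dots> = 1 / \<beta> c ^ block_pos (\<l> c) (J c)"
        using \<beta>[of c] by (simp add: exp_minus exp_of_nat_mult inverse_eq_divide)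
      finally show ?thesis .
    qed
    moreover have "(\<Prod>c\<in>UNIV. \<Prod>i<J c. 1 / real (card (B c i))) \<le> exp ((1 - \<epsilon>) * C0) * r powr s"
    proof -
      have "(\<Prod>c\<in>UNIV. \<Prod>i<J c. 1 / real (card (B c i))) \<le> (\<Prod>c\<in>UNIV. exp (- ((1 - \<epsilon>) * g c)))"
        using J(2) by (intro prod_mono) (auto intro!: prod_nonneg)
      also have "\<dots> = exp (- ((1 - \<epsilon>) * (\<Sum>c\<in>UNIV. g c)))"
        by (simp add: exp_sum[symmetric] sum_negf sum_distrib_left)
      also have "\<dots> \<le> exp ((1 - \<epsilon>) * C0 - s * t)"
      proof -
        \<comment> \<open>Only the factor \<open>sched k\<close> contributes the loss
          \<open>\<kappa> * t\<close>; hence \<open>D - \<kappa>\<close> appears instead of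
          \<open>D * (1 - \<kappa>)\<close>.\<close>
        have "(\<Sum>c\<in>UNIV. g c) = D * t - \<kappa> * t - D * (\<epsilon> * \<tau> k) - C0"
          by (simp add: g_def sum_subtractf D_def C0_def)
        moreover have "D * (\<epsilon> * \<tau> k) \<le> D * (\<epsilon> * t)" using k(1) \<epsilon> D1 by (intro mult_left_mono) auto
        ultimately have "(D - \<kappa> - D * \<epsilon>) * t - C0 \<le> (\<Sum>c\<in>UNIV. g c)" by (simp add: algebra_simps)
        then have "(1 - \<epsilon>) * ((D - \<kappa> - D * \<epsilon>) * t - C0) \<le> (1 - \<epsilon>) * (\<Sum>c\<in>UNIV. g c)" using \<epsilon> by (intro mult_left_mono) auto
        moreover have "s * t \<le> (1 - \<epsilon>) * (D - \<kappa> - D * \<epsilon>) * t" using s_le t by (intro mult_right_mono) auto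
        then have "s * t \<le> (1 - \<epsilon>) * ((D - \<kappa> - D * \<epsilon>) * t)" by (simp only: mult.assoc)
        ultimately show ?thesis
          unfolding exp_le_cancel_iff right_diff_distrib[of "1 - \<epsilon>" _ C0] by linarith
      qed
      also have "\<dots> = exp ((1 - \<epsilon>) * C0) * r powr s"
        using r by (simp add: powr_def t_def exp_add)
      finally show ?thesis .
    qed
    ultimately show "\<exists>J. (\<forall>c. r \<le> 1 / \<beta> c ^ block_pos (\<l> c) (J c)) \<and>
        (\<Prod>c\<in>UNIV. \<Prod>i<J c. 1 / real (card (B c i))) \<le> exp ((1 - \<epsilon>) * C0) * r powr s" by blast
  qed
qed

lemma product_dim_ge:
  fixes \<beta> :: "'d::finite \<Rightarrow> real" and \<psi> :: "'d \<Rightarrow> nat \<Rightarrow> real"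
  assumes \<beta>: "\<And>c. 1 < \<beta> c"
    and \<psi>: "\<And>c n. 0 < n \<Longrightarrow> 0 < \<psi> c n" "\<And>c i j. 0 < i \<Longrightarrow> i \<le> j \<Longrightarrow> \<psi> c j \<le> \<psi> c i" "\<And>c. \<psi> c \<longlonglongrightarrow> 0"
  shows "(MIN c. ereal (real CARD('d) - 1) + 1 / (1 + lower_order (\<beta> c) (\<psi> c)))
    \<le> hausdorff_dim {x :: real ^ 'd. \<forall>c. x $ c \<in> E_set (\<beta> c) (\<psi> c)}"
proof (rule ccontr)
  let ?f = "\<lambda>c. ereal (real CARD('d) - 1) + 1 / (1 + lower_order (\<beta> c) (\<psi> c))"
  let ?Q = "{x :: real ^ 'd. \<forall>c. x $ c \<in> E_set (\<beta> c) (\<psi> c)}"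
  assume "\<not> (MIN c. ?f c) \<le> hausdorff_dim ?Q"
  then obtain s where s: "hausdorff_dim ?Q < ereal s" "ereal s < (MIN c. ?f c)"
    using ereal_dense2[of "hausdorff_dim ?Q" "MIN c. ?f c"] by (auto simp: not_le)
  have "(MIN c. ?f c) \<le> ?f c" for c by (rule Min_le) auto
  then have "ereal s < ?f c" for c using s(2) by (rule less_le_trans[rotated])
  then have "ereal s \<le> hausdorff_dim ?Q" by (intro product_dim_ge_real \<beta> \<psi>)
  then show False using s(1) by simp
qed

theorem theorem1p4:
  fixes \<beta> :: "'d::finite \<Rightarrow> real"
    and \<psi> :: "'d \<Rightarrow> real \<Rightarrow> real"
  assumes "CARD('d) \<ge> 2"
    and "\<And>i. \<beta> i > 1"
    and "\<And>i x. x > 0 \<Longrightarrow> \<psi> i x > 0"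
    and "\<And>i. antimono_on {0<..} (\<psi> i)"
    and "\<And>i. (\<lambda>n::nat. \<psi> i (real n)) \<longlonglongrightarrow> 0"
  shows "hausdorff_dim {x :: real ^ 'd. \<forall>i. x $ i \<in> E_set (\<beta> i) (\<lambda>n. \<psi> i (real n))}
           = (MIN i. ereal (real CARD('d) - 1) + hausdorff_dim (E_set (\<beta> i) (\<lambda>n. \<psi> i (real n))))
       \<and> (MIN i. ereal (real CARD('d) - 1) + hausdorff_dim (E_set (\<beta> i) (\<lambda>n. \<psi> i (real n))))
           = (MIN i. ereal (real CARD('d) - 1) + 1 / (1 + lower_order (\<beta> i) (\<lambda>n. \<psi> i (real n))))"
proof -
  let ?\<phi> = "\<lambda>i n. \<psi> i (real n)" and ?c = "ereal (real CARD('d) - 1)"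
  let ?E = "\<lambda>i. E_set (\<beta> i) (?\<phi> i)" and ?f = "\<lambda>i. 1 / (1 + lower_order (\<beta> i) (?\<phi> i))"
  have pos: "0 < ?\<phi> i n" if "0 < n" for i n using assms(3)[of "real n"] that by simp
  have anti: "?\<phi> i k \<le> ?\<phi> i j" if "0 < j" "j \<le> k" for i j k
    using monotone_onD[OF assms(4)[of i], of "real j" "real k"] that by simp
  have E01: "?E i \<subseteq> {0..1}" for i by (auto simp: E_set_def W_set_def)
  have upper: "hausdorff_dim {x :: real ^ 'd. \<forall>i. x $ i \<in> ?E i} \<le> ?c + hausdorff_dim (?E i)" for i
    by (rule product_dim_le[OF E01])
  have dim: "hausdorff_dim (?E i) = ?f i" for i
  proof (rule antisym)
    show "hausdorff_dim (?E i) \<le> ?f i" using assms(2,5) pos by (intro E_set_dim_le)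
    have "(MIN j::'d. ?c + ?f i) \<le> hausdorff_dim {x :: real ^ 'd. \<forall>j. x $ j \<in> ?E i}"
      using assms(2,5) pos anti by (intro product_dim_ge[of "\<lambda>_. \<beta> i" "\<lambda>_. ?\<phi> i"])
    also have "\<dots> \<le> ?c + hausdorff_dim (?E i)" by (rule product_dim_le[OF E01])
    finally show "?f i \<le> hausdorff_dim (?E i)" by (simp add: ereal_add_le_add_iff)
  qed
  have lo: "(MIN i. ?c + ?f i) \<le> hausdorff_dim {x :: real ^ 'd. \<forall>i. x $ i \<in> ?E i}"
    using assms(2,5) pos anti by (intro product_dim_ge)
  have up: "hausdorff_dim {x :: real ^ 'd. \<forall>i. x $ i \<in> ?E i} \<le> (MIN i. ?c + hausdorff_dim (?E i))"
    using upper by (intro Min.boundedI) auto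
  have eq: "(MIN i. ?c + hausdorff_dim (?E i)) = (MIN i. ?c + ?f i)" by (simp only: dim)
  show ?thesis using antisym[OF up] lo eq by (intro conjI) simp_all
qed

end
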